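(* Let $r\geq 2$ be an integer, let $n$ be a positive integer, and let $c$ and $\varepsilon$ be real numbers satisfying $1/\ln n<c<r^{-8(r+21)(r+1)}$ and $0<\varepsilon<2^{-36}r^{-24}$. Let $G$ be a graph of order $n$. If $\mu(G)>(1-1/r-\varepsilon)n$, then $G$ satisfies at least one of the following conditions: (a) $G$ contains a subgraph isomorphic to $K_{r+1}\left(\lfloor c\ln n\rfloor,\ldots,\lfloor c\ln n\rfloor,\lceil n^{1-\sqrt{c}}\rceil\right)$, i.e., the complete $(r+1)$-partite graph with $r$ parts of size $\lfloor c\ln n\rfloor$ and one part of size $\lceil n^{1-\sqrt{c}}\rceil$; (b) $G$ differs from $T_r(n)$ in fewer than $\left(\varepsilon^{1/4}+c^{1/(8r+8)}\right)n^2$ edges.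
   Context: All graphs are finite and simple. $\mu(G)$ denotes the largest eigenvalue of the adjacency matrix of $G$. $K_{r}(s_1,\ldots,s_r)$ denotes the complete $r$-partite graph with parts of sizes $s_1,\ldots,s_r$. $T_r(n)$ denotes the $r$-partite Turán graph of order $n$, i.e., the complete $r$-partite graph on $n$ vertices whose part sizes differ by at most one. "$G$ differs from $T_r(n)$ in fewer than $m$ edges" means that $G$ can be transformed into a graph isomorphic to $T_r(n)$ (on the same vertex set) by adding and/or deleting fewer than $m$ edges in total. *)

theory Defs
  imports "Jordan_Normal_Form.Char_Poly"
begin

definition graph_on :: "nat \<Rightarrow> nat set set \<Rightarrow> bool" where
  "graph_on n E \<longleftrightarrow> (\<forall>e\<in>E. card e = 2 \<and> e \<subseteq> {..<n})"

definition adj_matrix :: "nat \<Rightarrow> nat set set \<Rightarrow> real mat" where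
  "adj_matrix n E = mat n n (\<lambda>(i,j). if {i,j} \<in> E then 1 else 0)"

text \<open>Largest eigenvalue of the adjacency matrix (real symmetric, so all eigenvalues are real).\<close>
definition spec_radius_graph :: "nat \<Rightarrow> nat set set \<Rightarrow> real" where
  "spec_radius_graph n E = Max {k. eigenvalue (adj_matrix n E) k}"

definition contains_complete_multipartite ::
  "nat \<Rightarrow> nat set set \<Rightarrow> nat \<Rightarrow> (nat \<Rightarrow> nat) \<Rightarrow> bool" where
  "contains_complete_multipartite n E m s \<longleftrightarrow>
     (\<exists>V :: nat \<Rightarrow> nat set.
        (\<forall>i<m. V i \<subseteq> {..<n} \<and> card (V i) = s i) \<and>
        (\<forall>i<m. \<forall>j<m. i \<noteq> j \<longrightarrow> V i \<inter> V j = {}) \<and>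
        (\<forall>i<m. \<forall>j<m. i \<noteq> j \<longrightarrow> (\<forall>x\<in>V i. \<forall>y\<in>V j. {x,y} \<in> E)))"

text \<open>Turan graph T_r(n) on {..<n}: parts are residue classes mod r (sizes differ by at most one).\<close>
definition turan_edges :: "nat \<Rightarrow> nat \<Rightarrow> nat set set" where
  "turan_edges r n = {{i,j} | i j. i < n \<and> j < n \<and> i mod r \<noteq> j mod r}"

definition differs_from_turan_lt :: "nat \<Rightarrow> nat set set \<Rightarrow> nat \<Rightarrow> real \<Rightarrow> bool" where
  "differs_from_turan_lt n E r m \<longleftrightarrow>
     (\<exists>\<pi>. bij_betw \<pi> {..<n} {..<n} \<and>
        real (card ((E - (`) \<pi> ` turan_edges r n) \<union> ((`) \<pi> ` turan_edges r n - E))) < m)"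

end

theory Submission
  imports Defs "HOL-Analysis.Convex" "HOL-Combinatorics.Multiset_Permutations"
    "Jordan_Normal_Form.Spectral_Radius"
begin

text \<open>
  If \<open>G\<close> has many \<open>(r+1)\<close>-cliques, one builds the complete multipartite subgraph part by part:
  the \<open>k\<close>-cliques with many extensions to given \<open>(k+1)\<close>-cliques are still numerous, and among
  logarithmically many such cliques forming a complete multipartite graph the pigeonhole principle on
  subsets yields a positive proportion with a large common set of extensions.

  If \<open>G\<close> has few \<open>(r+1)\<close>-cliques, let \<open>x\<close> be a unit eigenvector for \<open>\<mu>(G)\<close> and weight the vertices by
  \<open>x\<^sup>2\<close>; these weights are \<open>O(1/n)\<close>, so the weighted density of \<open>(r+1)\<close>-cliques is small as well.
  The weighted Moon--Moser inequalities then give a robust Motzkin--Straus bound, and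
  \<open>\<mu>\<^sup>2 \<le> 2e(G) \<cdot> 2\<Sum> x\<^sub>i\<^sup>2 x\<^sub>j\<^sup>2\<close> (Cauchy--Schwarz, sum over edges) shows that \<open>G\<close> has almost as many edges as
  the Turan graph. By near-tightness of Moon--Moser, for a random \<open>r\<close>-clique \<open>Q\<close> almost every vertex
  is adjacent to all of \<open>Q - {v}\<close> for some \<open>v \<in> Q\<close>; classifying vertices by this \<open>v\<close> gives \<open>r\<close> parts
  spanning few inner edges, since an inner edge of the part of \<open>v\<close> forms an
  \<open>(r+1)\<close>-clique with \<open>Q - {v}\<close>. The edge count forces the parts to be nearly balanced and nearly
  completely joined.
\<close>

subsection \<open>Weighted cliques and the Moon--Moser inequality\<close>

locale fin_graph =
  fixes V :: "'a set" and adj :: "'a \<Rightarrow> 'a \<Rightarrow> bool"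
  assumes finite_V: "finite V"
    and adj_sym: "adj u v \<Longrightarrow> adj v u"
    and adj_irrefl: "\<not> adj v v"
begin

definition cliques :: "nat \<Rightarrow> 'a set set" where
  "cliques s = {K. K \<subseteq> V \<and> card K = s \<and> (\<forall>u\<in>K. \<forall>v\<in>K. u \<noteq> v \<longrightarrow> adj u v)}"

definition nbhd :: "'a set \<Rightarrow> 'a set" where
  "nbhd R = {v \<in> V. \<forall>u\<in>R. adj u v}"

lemma finite_cliques: "finite (cliques s)"
  by (rule finite_subset[of _ "Pow V"]) (auto simp: cliques_def finite_V)

lemma finite_clique: "K \<in> cliques s \<Longrightarrow> finite K"
  using finite_V finite_subset by (auto simp: cliques_def)

lemma clique_subset: "K \<in> cliques s \<Longrightarrow> K \<subseteq> V"
  by (auto simp: cliques_def)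

lemma clique_card: "K \<in> cliques s \<Longrightarrow> card K = s"
  by (auto simp: cliques_def)

lemma finite_nbhd: "finite (nbhd R)"
  using finite_V by (auto simp: nbhd_def)

lemma nbhd_subset: "nbhd R \<subseteq> V"
  by (auto simp: nbhd_def)

lemma nbhd_notin: "v \<in> nbhd R \<Longrightarrow> v \<notin> R"
  using adj_irrefl by (auto simp: nbhd_def)

lemma cliques_1: "cliques (Suc 0) = (\<lambda>v. {v}) ` V"
  by (auto simp: cliques_def card_Suc_eq)

lemma clique_insert: "R \<in> cliques s \<Longrightarrow> v \<in> nbhd R \<Longrightarrow> insert v R \<in> cliques (Suc s)"
proof -
  assume R: "R \<in> cliques s" and v: "v \<in> nbhd R"
  have "adj u v \<and> adj v u" if "u \<in> R" for u
    using v that adj_sym[of u v] by (auto simp: nbhd_def)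
  then show ?thesis
    using R v nbhd_notin[OF v] finite_clique[OF R] by (auto simp: cliques_def nbhd_def)
qed

lemma clique_remove:
  assumes "Q \<in> cliques (Suc s)" "v \<in> Q"
  shows "Q - {v} \<in> cliques s" "v \<in> nbhd (Q - {v})"
  using assms finite_clique[OF assms(1)] by (auto simp: cliques_def nbhd_def)

text \<open>Double counting: a clique \<open>Q\<close> with a marked vertex \<open>v\<close> is the
  same thing as the clique \<open>R = Q - {v}\<close> with a marked vertex of its common
  neighbourhood. Averaging over cliques rests on this exchange.\<close>

lemma sum_cliques_Suc:
  fixes F :: "'a set \<Rightarrow> 'a \<Rightarrow> real"
  shows "(\<Sum>Q\<in>cliques (Suc s). \<Sum>v\<in>Q. F (Q - {v}) v) = (\<Sum>R\<in>cliques s. \<Sum>v\<in>nbhd R. F R v)"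
proof -
  have "(\<Sum>Q\<in>cliques (Suc s). \<Sum>v\<in>Q. F (Q - {v}) v)
      = (\<Sum>(Q,v)\<in>Sigma (cliques (Suc s)) (\<lambda>Q. Q). F (Q - {v}) v)"
    by (rule sum.Sigma) (auto simp: finite_cliques finite_clique)
  also have "\<dots> = (\<Sum>(R,v)\<in>Sigma (cliques s) nbhd. F R v)"
    by (rule sum.reindex_bij_witness[where j = "\<lambda>(Q,v). (Q - {v}, v)" and i = "\<lambda>(R,v). (insert v R, v)"])
      (auto simp: clique_remove clique_insert nbhd_notin)
  also have "\<dots> = (\<Sum>R\<in>cliques s. \<Sum>v\<in>nbhd R. F R v)"
    by (rule sum.Sigma[symmetric]) (auto simp: finite_cliques finite_nbhd)
  finally show ?thesis .
qed

text \<open>For a nonempty clique \<open>Q\<close> these are the vertices with at least two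
  non-neighbours in \<open>Q\<close>. A member of \<open>Q\<close> has only itself as a
  non-neighbour there, so it is covered.\<close>

definition uncovered :: "'a set \<Rightarrow> 'a set" where
  "uncovered Q = V - (\<Union>v\<in>Q. nbhd (Q - {v}))"

text \<open>The sum over \<open>v\<close> counts a vertex \<open>s\<close> times if it sees all of
  \<open>Q\<close>, once if it misses exactly one vertex of \<open>Q\<close>, and never if it misses
  more. With the uncovered term the usual inequality becomes an identity that records the slack,
  which the stability argument exploits.\<close>

lemma codegree_identity:
  fixes y :: "'a \<Rightarrow> real"
  assumes Q: "Q \<in> cliques s" and s: "s \<ge> 1"
  shows "(\<Sum>v\<in>Q. sum y (nbhd (Q - {v}))) + sum y (uncovered Q)
       = sum y V + (real s - 1) * sum y (nbhd Q)"
proof -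
  have fQ: "finite Q" using Q by (rule finite_clique)
  have cQ: "card Q = s" using Q by (rule clique_card)
  have ind: "sum y W = (\<Sum>u\<in>V. if u \<in> W then y u else 0)" if "W \<subseteq> V" for W
    using that finite_V by (simp add: sum.If_cases Int_absorb1)
  have pt: "(\<Sum>v\<in>Q. if u \<in> nbhd (Q - {v}) then y u else 0) + (if u \<in> uncovered Q then y u else 0)
      = y u + (real s - 1) * (if u \<in> nbhd Q then y u else 0)" if u: "u \<in> V" for u
  proof -
    define P where "P = {v\<in>Q. u \<in> nbhd (Q - {v})}"
    have "(\<Sum>v\<in>Q. if u \<in> nbhd (Q - {v}) then y u else 0) = (\<Sum>v\<in>P. y u)"
      unfolding P_def by (rule sum.inter_filter[symmetric]) (rule fQ)
    then have e: "(\<Sum>v\<in>Q. if u \<in> nbhd (Q - {v}) then y u else 0) = real (card P) * y u" by simp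
    \<comment> \<open>The vertex \<open>u\<close> misses no vertex of \<open>Q\<close>, at least two
      of them, or exactly \<open>v\<close>.\<close>
    consider "u \<in> nbhd Q" | "u \<notin> nbhd Q" "P = {}" | v where "u \<notin> nbhd Q" "v \<in> P" by blast
    then show ?thesis
    proof cases
      case 1
      then have "P = Q" by (auto simp: P_def nbhd_def)
      moreover have "Q \<noteq> {}" using cQ s by auto
      ultimately have "u \<notin> uncovered Q" by (auto simp: uncovered_def P_def)
      then show ?thesis using e 1 cQ \<open>P = Q\<close> by (simp add: algebra_simps)
    next
      case 2
      then have "u \<in> uncovered Q" using u by (auto simp: uncovered_def P_def)
      then show ?thesis using e 2 by simp
    next
      case 3
      have "w = v" if "w \<in> P" for w
      proof (rule ccontr)
        assume "w \<noteq> v"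
        then have "u \<in> nbhd Q" using that 3(2) u by (auto simp: P_def nbhd_def)
        with 3 show False by simp
      qed
      then have "P = {v}" using 3(2) by blast
      moreover have "u \<notin> uncovered Q" using 3(2) by (auto simp: P_def uncovered_def)
      ultimately show ?thesis using e 3 by simp
    qed
  qed
  have "(\<Sum>v\<in>Q. sum y (nbhd (Q - {v}))) + sum y (uncovered Q)
     = (\<Sum>v\<in>Q. \<Sum>u\<in>V. if u \<in> nbhd (Q - {v}) then y u else 0) + (\<Sum>u\<in>V. if u \<in> uncovered Q then y u else 0)"
    by (intro arg_cong2[where f = "(+)"] sum.cong ind) (auto simp: nbhd_subset uncovered_def nbhd_def)
  also have "\<dots> = (\<Sum>u\<in>V. (\<Sum>v\<in>Q. if u \<in> nbhd (Q - {v}) then y u else 0) + (if u \<in> uncovered Q then y u else 0))"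
    by (subst sum.swap) (simp add: sum.distrib)
  also have "\<dots> = (\<Sum>u\<in>V. y u + (real s - 1) * (if u \<in> nbhd Q then y u else 0))"
    by (rule sum.cong) (auto simp: pt)
  also have "\<dots> = sum y V + (real s - 1) * sum y (nbhd Q)"
    using ind[OF nbhd_subset, of Q] by (simp add: sum.distrib sum_distrib_left)
  finally show ?thesis .
qed

text \<open>The clique polynomial of the graph evaluated at \<open>y\<close>; for
  \<open>s = 2\<close> it is the form maximised in the Motzkin--Straus theorem.\<close>

definition clique_weight :: "('a \<Rightarrow> real) \<Rightarrow> nat \<Rightarrow> real" where
  "clique_weight y s = (\<Sum>K\<in>cliques s. prod y K)"

text \<open>The factor \<open>fact s\<close> counts orderings: for the constant weight \<open>1 / card V\<close> this is the
  homomorphism density of the complete graph on \<open>s\<close> vertices.\<close>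

definition clique_density :: "('a \<Rightarrow> real) \<Rightarrow> nat \<Rightarrow> real" where
  "clique_density y s = fact s * clique_weight y s"

context
  fixes y :: "'a \<Rightarrow> real"
  assumes y_nonneg: "\<And>v. y v \<ge> 0"
begin

lemma clique_weight_nonneg: "clique_weight y s \<ge> 0"
  unfolding clique_weight_def by (intro sum_nonneg prod_nonneg) (auto simp: y_nonneg)

lemma clique_density_nonneg: "clique_density y s \<ge> 0"
  unfolding clique_density_def by (simp add: clique_weight_nonneg)

lemma prod_clique_remove:
  assumes "Q \<in> cliques s" "v \<in> Q"
  shows "prod y Q = prod y (Q - {v}) * y v"
  using prod.remove[OF finite_clique[OF assms(1)] assms(2)] by (simp add: mult.commute)

lemma clique_weight_Suc: "real (Suc s) * clique_weight y (Suc s) = (\<Sum>R\<in>cliques s. prod y R * sum y (nbhd R))"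
proof -
  have "real (Suc s) * clique_weight y (Suc s) = (\<Sum>Q\<in>cliques (Suc s). \<Sum>v\<in>Q. prod y Q)"
    by (simp add: clique_weight_def sum_distrib_left clique_card)
  also have "\<dots> = (\<Sum>Q\<in>cliques (Suc s). \<Sum>v\<in>Q. prod y (Q - {v}) * y v)"
    by (intro sum.cong refl prod_clique_remove)
  also have "\<dots> = (\<Sum>R\<in>cliques s. \<Sum>v\<in>nbhd R. prod y R * y v)"
    by (rule sum_cliques_Suc)
  finally show ?thesis by (simp add: sum_distrib_left)
qed

lemma sum_codegree:
  "(\<Sum>Q\<in>cliques (Suc s). prod y Q * (\<Sum>v\<in>Q. D (Q - {v})))
     = (\<Sum>R\<in>cliques s. prod y R * sum y (nbhd R) * D R)"
proof -
  have "(\<Sum>Q\<in>cliques (Suc s). prod y Q * (\<Sum>v\<in>Q. D (Q - {v})))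
      = (\<Sum>Q\<in>cliques (Suc s). \<Sum>v\<in>Q. prod y (Q - {v}) * y v * D (Q - {v}))"
    by (auto simp: sum_distrib_left prod_clique_remove intro!: sum.cong)
  also have "\<dots> = (\<Sum>R\<in>cliques s. \<Sum>v\<in>nbhd R. prod y R * y v * D R)"
    by (rule sum_cliques_Suc)
  finally show ?thesis by (simp add: sum_distrib_left sum_distrib_right)
qed

text \<open>Cauchy--Schwarz with the weights \<open>prod y R\<close>. The squared codegree turns
  into a sum over \<open>(s+1)\<close>-cliques because one factor \<open>sum y (nbhd R)\<close> is
  spent on extending \<open>R\<close>.\<close>

lemma sum_codegree_sq:
  "(real (Suc s) * clique_weight y (Suc s))\<^sup>2
     \<le> clique_weight y s * (\<Sum>Q\<in>cliques (Suc s). prod y Q * (\<Sum>v\<in>Q. sum y (nbhd (Q - {v}))))"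
proof -
  have nn: "prod y R \<ge> 0" for R by (intro prod_nonneg) (auto simp: y_nonneg)
  have "(\<Sum>R\<in>cliques s. sqrt (prod y R) * (sqrt (prod y R) * sum y (nbhd R)))\<^sup>2
     \<le> (\<Sum>R\<in>cliques s. (sqrt (prod y R))\<^sup>2) * (\<Sum>R\<in>cliques s. (sqrt (prod y R) * sum y (nbhd R))\<^sup>2)"
    by (rule Cauchy_Schwarz_ineq_sum)
  then have "(\<Sum>R\<in>cliques s. prod y R * sum y (nbhd R))\<^sup>2
     \<le> clique_weight y s * (\<Sum>R\<in>cliques s. prod y R * (sum y (nbhd R))\<^sup>2)"
    by (simp add: nn power_mult_distrib clique_weight_def mult.assoc[symmetric])
  then show ?thesis
    unfolding clique_weight_Suc[symmetric]
    by (simp add: sum_codegree[where D = "\<lambda>R. sum y (nbhd R)"] power2_eq_square mult.assoc)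
qed

text \<open>This is \<open>codegree_identity\<close> averaged over the \<open>(s+1)\<close>-cliques;
  extending \<open>Q\<close> by a common neighbour produces the
  \<open>(s+2)\<close>-cliques.\<close>

lemma sum_codegree_uncovered:
  assumes "sum y V = 1"
  shows "(\<Sum>Q\<in>cliques (Suc s). prod y Q * (\<Sum>v\<in>Q. sum y (nbhd (Q - {v}))))
       + (\<Sum>Q\<in>cliques (Suc s). prod y Q * sum y (uncovered Q))
     = clique_weight y (Suc s) + real s * (real (s + 2) * clique_weight y (s + 2))"
proof -
  have "(\<Sum>Q\<in>cliques (Suc s). prod y Q * (\<Sum>v\<in>Q. sum y (nbhd (Q - {v}))))
       + (\<Sum>Q\<in>cliques (Suc s). prod y Q * sum y (uncovered Q))
     = (\<Sum>Q\<in>cliques (Suc s). prod y Q * ((\<Sum>v\<in>Q. sum y (nbhd (Q - {v}))) + sum y (uncovered Q)))"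
    by (simp add: sum.distrib distrib_left)
  also have "\<dots> = (\<Sum>Q\<in>cliques (Suc s). prod y Q + real s * (prod y Q * sum y (nbhd Q)))"
    by (intro sum.cong refl) (subst codegree_identity, auto simp: assms algebra_simps)
  also have "\<dots> = clique_weight y (Suc s) + real s * (\<Sum>Q\<in>cliques (Suc s). prod y Q * sum y (nbhd Q))"
    by (simp add: sum.distrib clique_weight_def sum_distrib_left)
  finally show ?thesis using clique_weight_Suc[of "Suc s"] by simp
qed

text \<open>The two preceding estimates of the codegree sum are compared. Here the uncovered weight
  is dropped as nonnegative, whereas \<open>exists_good_clique\<close> keeps it.\<close>

lemma moon_moser:
  assumes "sum y V = 1"
  shows "real (Suc s) * (clique_density y (Suc s))\<^sup>2 \<le> clique_density y s * (clique_density y (Suc s) + real s * clique_density y (s + 2))"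
proof -
  have un: "(\<Sum>Q\<in>cliques (Suc s). prod y Q * sum y (uncovered Q)) \<ge> 0"
    by (intro sum_nonneg mult_nonneg_nonneg prod_nonneg) (auto simp: y_nonneg)
  have "(real (Suc s) * clique_weight y (Suc s))\<^sup>2
     \<le> clique_weight y s * (\<Sum>Q\<in>cliques (Suc s). prod y Q * (\<Sum>v\<in>Q. sum y (nbhd (Q - {v}))))"
    by (rule sum_codegree_sq)
  also have "\<dots> \<le> clique_weight y s * (clique_weight y (Suc s) + real s * (real (s + 2) * clique_weight y (s + 2)))"
    using sum_codegree_uncovered[OF assms, of s] un by (intro mult_left_mono clique_weight_nonneg) linarith
  finally have *: "(real (Suc s) * clique_weight y (Suc s))\<^sup>2
     \<le> clique_weight y s * (clique_weight y (Suc s) + real s * (real (s + 2) * clique_weight y (s + 2)))" .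
  have "real (Suc s) * (clique_density y (Suc s))\<^sup>2
      = (fact s * fact (Suc s)) * (real (Suc s) * clique_weight y (Suc s))\<^sup>2"
    by (simp add: clique_density_def power2_eq_square algebra_simps)
  also have "\<dots> \<le> (fact s * fact (Suc s))
      * (clique_weight y s * (clique_weight y (Suc s) + real s * (real (s + 2) * clique_weight y (s + 2))))"
    using * by (intro mult_left_mono) auto
  also have "\<dots> = clique_density y s * (clique_density y (Suc s) + real s * clique_density y (s + 2))"
    by (simp add: clique_density_def algebra_simps)
  finally show ?thesis .
qed

section \<open>Lower bounds on clique densities\<close>

lemma clique_density_1: "clique_density y 1 = sum y V"
proof -
  have "inj_on (\<lambda>v. {v}) V" by auto
  then show ?thesis by (simp add: clique_density_def clique_weight_def cliques_1 sum.reindex)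
qed

text \<open>Moon--Moser passes a bound from one ratio of consecutive densities to the next: a ratio
  at least \<open>q\<close> at index \<open>s\<close> forces at least
  \<open>((s+1) * q - 1) / s\<close> at index \<open>s+1\<close>, and \<open>q = 1 - s*d\<close>
  yields \<open>1 - (s+1)*d\<close>. The condition on \<open>d\<close> keeps the lower bounds
  positive at all indices below \<open>r\<close>, so that the densities can be cancelled.\<close>

lemma clique_density_chain:
  assumes y1: "sum y V = 1" and d: "clique_density y 2 = 1 - d" and rd: "(real r - 1) * d < 1" and d0: "d \<ge> 0"
    and s: "1 \<le> s" "s \<le> r"
  shows "clique_density y s > 0 \<and> clique_density y (Suc s) \<ge> (1 - real s * d) * clique_density y s"
  using s
proof (induction s rule: nat_induct_at_least)
  case base
  then show ?case using clique_density_1 y1 d by (simp add: numeral_2_eq_2)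
next
  case (Suc s)
  have IH: "clique_density y s > 0" "clique_density y (Suc s) \<ge> (1 - real s * d) * clique_density y s" using Suc by auto
  have "real s * d \<le> (real r - 1) * d" using Suc d0 by (intro mult_right_mono) auto
  then have p: "1 - real s * d > 0" using rd by linarith
  have pos: "clique_density y (Suc s) > 0" using IH p by (meson less_le_trans mult_pos_pos)
  have s0: "real s > 0" using Suc by simp
  let ?a = "clique_density y s" and ?b = "clique_density y (Suc s)" and ?e = "clique_density y (s + 2)"
  have "real (Suc s) * ?b * ((1 - real s * d) * ?a) \<le> real (Suc s) * ?b * ?b"
    using IH pos by (intro mult_left_mono) auto
  also have "\<dots> \<le> ?a * (?b + real s * ?e)"
    using moon_moser[OF y1, of s] by (simp add: power2_eq_square mult.assoc)
  finally have "?a * (real (Suc s) * ?b * (1 - real s * d)) \<le> ?a * (?b + real s * ?e)"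
    by (simp add: algebra_simps)
  then have "real (Suc s) * ?b * (1 - real s * d) \<le> ?b + real s * ?e"
    using IH(1) by (simp add: mult_le_cancel_left_pos)
  then have "real s * ((1 - real (Suc s) * d) * ?b) \<le> real s * ?e"
    by (simp add: algebra_simps)
  then have "(1 - real (Suc s) * d) * ?b \<le> ?e"
    using s0 mult_le_cancel_left_pos by blast
  then show ?case using pos by simp
qed

text \<open>Starting from total weight 1, the density of \<open>s\<close>-cliques is a product of
  \<open>s - 1\<close> ratios, each at least \<open>b\<close>.\<close>

lemma clique_density_lower:
  assumes y1: "sum y V = 1" and d: "clique_density y 2 = 1 - d" and d0: "d \<ge> 0"
    and b: "b > 0" "(real r - 1) * d \<le> 1 - b" and s: "1 \<le> s" "s \<le> r"
  shows "clique_density y s \<ge> b ^ (s - 1)"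
  using s
proof (induction s rule: nat_induct_at_least)
  case base
  then show ?case using clique_density_1 y1 by simp
next
  case (Suc s)
  have IH: "b ^ (s - 1) \<le> clique_density y s" using Suc by simp
  have "real s * d \<le> (real r - 1) * d" using Suc d0 by (intro mult_right_mono) auto
  then have p: "1 - real s * d \<ge> b" using b by linarith
  have "b ^ (Suc s - 1) = b * b ^ (s - 1)" using Suc by (cases s) auto
  also have "\<dots> \<le> (1 - real s * d) * clique_density y s" using IH p b by (intro mult_mono) auto
  also have "\<dots> \<le> clique_density y (Suc s)"
    using clique_density_chain[OF y1 d _ d0, of r s] b Suc by auto
  finally show ?case .
qed

lemma sum_nbhd_le_1:
  assumes y1: "sum y V = 1"
  shows "sum y (nbhd R) \<le> 1"
  unfolding y1[symmetric] by (rule sum_mono2[OF finite_V nbhd_subset]) (rule y_nonneg)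

lemma clique_density_2_le_1:
  assumes y1: "sum y V = 1"
  shows "clique_density y 2 \<le> 1"
proof -
  have "clique_weight y 2 * 2 = (\<Sum>R\<in>cliques 1. prod y R * sum y (nbhd R))"
    using clique_weight_Suc[of 1] by (simp add: numeral_2_eq_2)
  also have "\<dots> \<le> (\<Sum>R\<in>cliques 1. prod y R * 1)"
    by (intro sum_mono mult_left_mono prod_nonneg sum_nbhd_le_1[OF y1]) (auto simp: y_nonneg)
  also have "\<dots> = clique_density y 1" by (simp add: clique_density_def clique_weight_def)
  also have "\<dots> = 1" using clique_density_1 y1 by simp
  finally show ?thesis by (simp add: clique_density_def)
qed

text \<open>If the edge density exceeds \<open>1 - 1/r\<close>, the chain of ratios forces
  \<open>(r+1)\<close>-cliques in proportion to the excess. In the absence of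
  \<open>(r+1)\<close>-cliques this is the Motzkin--Straus bound.\<close>

lemma motzkin_straus_robust:
  assumes y1: "sum y V = 1" and r: "r \<ge> 2"
  shows "clique_density y 2 \<le> 1 - 1 / real r + real r ^ r * clique_density y (r + 1)"
proof (cases "clique_density y 2 \<le> 1 - 1 / real r")
  case True
  then show ?thesis using clique_density_nonneg[of "r+1"] by (smt (verit) mult_nonneg_nonneg of_nat_0_le_iff zero_le_power)
next
  case False
  define d where "d = 1 - clique_density y 2"
  have d: "clique_density y 2 = 1 - d" by (simp add: d_def)
  have dr: "d < 1 / real r" using False by (simp add: d_def)
  have d0: "d \<ge> 0" using clique_density_2_le_1[OF y1] by (simp add: d_def)
  have "(real r - 1) * d \<le> (real r - 1) * (1 / real r)"
    using dr r by (intro mult_left_mono) auto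
  also have "\<dots> = 1 - 1 / real r" using r by (simp add: field_simps)
  finally have rd: "(real r - 1) * d \<le> 1 - 1 / real r" .
  moreover have "1 / real r > 0" using r by simp
  ultimately have rd': "(real r - 1) * d < 1" by linarith
  have hr: "clique_density y r \<ge> (1 / real r) ^ (r - 1)"
    using clique_density_lower[OF y1 d d0 _ rd, of r] r by auto
  have t: "1 - real r * d > 0" using dr r by (simp add: field_simps)
  have "(1 - real r * d) * (1 / real r) ^ (r - 1) \<le> (1 - real r * d) * clique_density y r"
    using hr t by (intro mult_left_mono) auto
  also have "\<dots> \<le> clique_density y (r + 1)" using clique_density_chain[OF y1 d rd' d0, of r] r by auto
  finally have "(1 - real r * d) * (1 / real r) ^ (r - 1) \<le> clique_density y (r + 1)" .
  then have "real r ^ (r - 1) * ((1 - real r * d) * (1 / real r) ^ (r - 1)) \<le> real r ^ (r - 1) * clique_density y (r + 1)"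
    by (intro mult_left_mono) auto
  moreover have "real r ^ (r - 1) * (1 / real r) ^ (r - 1) = 1"
    using r by (simp add: power_mult_distrib[symmetric])
  ultimately have "1 - real r * d \<le> real r ^ (r - 1) * clique_density y (r + 1)"
    by (metis mult.left_commute mult.right_neutral)
  also have "\<dots> \<le> real r * (real r ^ r * clique_density y (r + 1))"
  proof -
    have "real r ^ (r - 1) \<le> real r ^ (Suc r)" using r by (intro power_increasing) auto
    then show ?thesis using clique_density_nonneg[of "r+1"] mult_right_mono by fastforce
  qed
  finally have "1 / real r - d \<le> real r ^ r * clique_density y (r + 1)"
    using r by (simp add: field_simps)
  then show ?thesis using d by simp
qed

end

end

subsection \<open>A partition from a typical clique\<close>

lemma sum_UN_le:
  fixes f :: "'b \<Rightarrow> real"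
  assumes "finite I" "\<And>i. i \<in> I \<Longrightarrow> finite (A i)" "\<And>x. f x \<ge> 0"
  shows "sum f (\<Union>i\<in>I. A i) \<le> (\<Sum>i\<in>I. sum f (A i))"
  using assms(1,2)
proof (induction I rule: finite_induct)
  case (insert i I)
  have "sum f (\<Union>j\<in>insert i I. A j) \<le> sum f (A i) + sum f (\<Union>j\<in>I. A j)"
    using sum.union_inter[of "A i" "\<Union>j\<in>I. A j" f] sum_nonneg[of "A i \<inter> (\<Union>j\<in>I. A j)" f] insert assms(3)
    by auto
  then show ?case using insert by auto
qed auto

context fin_graph
begin

text \<open>Ordered pairs are summed, so every edge inside \<open>W\<close> counts twice, as it does
  in \<open>clique_density y 2\<close>.\<close>

definition inner_weight :: "('a \<Rightarrow> real) \<Rightarrow> 'a set \<Rightarrow> real" where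
  "inner_weight y W = (\<Sum>(a,b)\<in>{(a,b). a \<in> W \<and> b \<in> W \<and> adj a b}. y a * y b)"

context
  fixes y :: "'a \<Rightarrow> real"
  assumes y_nonneg: "\<And>v. y v \<ge> 0" and y1: "sum y V = 1"
begin

lemma inner_weight_nonneg: "inner_weight y W \<ge> 0"
  unfolding inner_weight_def by (intro sum_nonneg) (auto simp: y_nonneg)

lemma inner_weight_nbhd: "inner_weight y (nbhd R) = (\<Sum>a\<in>nbhd R. y a * sum y (nbhd (insert a R)))"
proof -
  have eq: "{(a,b). a \<in> nbhd R \<and> b \<in> nbhd R \<and> adj a b} = Sigma (nbhd R) (\<lambda>a. nbhd (insert a R))"
    by (auto simp: nbhd_def)
  show ?thesis
    unfolding inner_weight_def eq by (subst sum.Sigma[symmetric]) (auto simp: finite_nbhd sum_distrib_left)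
qed

text \<open>An edge inside \<open>nbhd R\<close> completes the \<open>s\<close>-clique
  \<open>R\<close> to an \<open>(s+2)\<close>-clique, so inner edges are paid for by larger cliques.
  The factor \<open>sum y (nbhd R)\<close> is bounded by 1.\<close>

lemma sum_inner_weight:
  "(\<Sum>Q\<in>cliques (Suc s). prod y Q * (\<Sum>v\<in>Q. inner_weight y (nbhd (Q - {v}))))
     \<le> real (s + 1) * (real (s + 2) * clique_weight y (s + 2))"
proof -
  have nn: "prod y R \<ge> 0" for R by (intro prod_nonneg) (auto simp: y_nonneg)
  have "(\<Sum>Q\<in>cliques (Suc s). prod y Q * (\<Sum>v\<in>Q. inner_weight y (nbhd (Q - {v}))))
      = (\<Sum>R\<in>cliques s. prod y R * sum y (nbhd R) * inner_weight y (nbhd R))"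
    by (rule sum_codegree[OF y_nonneg])
  also have "\<dots> \<le> (\<Sum>R\<in>cliques s. prod y R * 1 * inner_weight y (nbhd R))"
    by (intro sum_mono mult_right_mono mult_left_mono sum_nbhd_le_1 nn inner_weight_nonneg y_nonneg y1)
  also have "\<dots> = (\<Sum>R\<in>cliques s. \<Sum>a\<in>nbhd R. prod y R * y a * sum y (nbhd (insert a R)))"
    by (simp add: inner_weight_nbhd sum_distrib_left mult.assoc)
  also have "\<dots> = (\<Sum>Q\<in>cliques (Suc s). \<Sum>a\<in>Q. prod y (Q - {a}) * y a * sum y (nbhd (insert a (Q - {a}))))"
    by (rule sum_cliques_Suc[symmetric])
  also have "\<dots> = (\<Sum>Q\<in>cliques (Suc s). \<Sum>a\<in>Q. prod y Q * sum y (nbhd Q))"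
    by (intro sum.cong refl) (auto simp: prod_clique_remove[OF y_nonneg] insert_absorb)
  also have "\<dots> = real (s + 1) * (\<Sum>Q\<in>cliques (Suc s). prod y Q * sum y (nbhd Q))"
    by (simp add: clique_card sum_distrib_left)
  also have "\<dots> = real (s + 1) * (real (s + 2) * clique_weight y (s + 2))"
    using clique_weight_Suc[OF y_nonneg, of "Suc s"] by simp
  finally show ?thesis .
qed

text \<open>The bound holds for the average over \<open>r\<close>-cliques \<open>Q\<close> chosen with probability proportional to
  \<open>prod y Q\<close>.\<close>

lemma exists_good_clique:
  assumes d: "clique_density y 2 = 1 - d" and d0: "d \<ge> 0" and r: "r \<ge> 2" and rd: "(real r - 1) * d < 1"
  shows "\<exists>Q\<in>cliques r. 2 * sum y (uncovered Q) + (\<Sum>v\<in>Q. inner_weight y (nbhd (Q - {v})))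
     \<le> 2 * (1 - real r * (1 - (real r - 1) * d)) + 3 * real r * (clique_density y (r + 1) / clique_density y r)"
proof -
  \<comment> \<open>With \<open>s = r - 1\<close> the codegree sums run over
    \<open>r\<close>-cliques and involve the clique weights of sizes \<open>r - 1\<close>,
    \<open>r\<close> and \<open>r + 1\<close>.\<close>
  obtain s where s: "r = Suc s" "s \<ge> 1" using r by (cases r) auto
  define B where "B = 2 * (1 - real r * (1 - (real r - 1) * d)) + 3 * real r * (clique_density y (r + 1) / clique_density y r)"
  define F where "F Q = 2 * sum y (uncovered Q) + (\<Sum>v\<in>Q. inner_weight y (nbhd (Q - {v})))" for Q
  have nn: "prod y R \<ge> 0" for R by (intro prod_nonneg) (auto simp: y_nonneg)
  have hs: "clique_density y s > 0" "clique_density y r \<ge> (1 - real s * d) * clique_density y s"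
    using clique_density_chain[OF y_nonneg y1 d rd d0, of s] s by auto
  have hr: "clique_density y r > 0"
    using clique_density_chain[OF y_nonneg y1 d rd d0, of r] r by auto
  have ws: "clique_weight y s > 0" and wr: "clique_weight y r > 0" using hs(1) hr
    by (auto simp: clique_density_def zero_less_mult_iff)
  have ratio: "real r * clique_weight y r \<ge> (1 - real s * d) * clique_weight y s"
  proof -
    have "fact s * (real r * clique_weight y r) \<ge> fact s * ((1 - real s * d) * clique_weight y s)"
      using hs(2) s by (simp add: clique_density_def algebra_simps)
    then show ?thesis by simp
  qed
  define Z where "Z = (\<Sum>Q\<in>cliques (Suc s). prod y Q * (\<Sum>v\<in>Q. sum y (nbhd (Q - {v}))))"
  \<comment> \<open>This lower bound on \<open>Z\<close>, set against the identity
    \<open>sum_codegree_uncovered\<close>, leaves little room for the uncovered weight.\<close>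
  have "clique_weight y s * (real r * (1 - real s * d) * clique_weight y r) = real r * clique_weight y r * ((1 - real s * d) * clique_weight y s)"
    by (simp add: algebra_simps)
  also have "\<dots> \<le> real r * clique_weight y r * (real r * clique_weight y r)"
    using ratio wr by (intro mult_left_mono) auto
  also have "\<dots> \<le> clique_weight y s * Z"
    using sum_codegree_sq[OF y_nonneg, of s] s by (simp add: Z_def power2_eq_square)
  finally have Z: "real r * (1 - real s * d) * clique_weight y r \<le> Z"
    using ws by (simp add: mult_le_cancel_left_pos)
  have rat2: "real (r + 1) * clique_weight y (r + 1) = clique_density y (r + 1) / clique_density y r * clique_weight y r"
    using wr by (simp add: clique_density_def field_simps)
  have "(\<Sum>Q\<in>cliques r. prod y Q * F Q)
      = 2 * (\<Sum>Q\<in>cliques (Suc s). prod y Q * sum y (uncovered Q))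
        + (\<Sum>Q\<in>cliques (Suc s). prod y Q * (\<Sum>v\<in>Q. inner_weight y (nbhd (Q - {v}))))"
    by (simp add: F_def s sum.distrib sum_distrib_left algebra_simps)
  also have "\<dots> \<le> 2 * (clique_weight y r + real s * (real (r + 1) * clique_weight y (r + 1)) - Z) + real r * (real (r + 1) * clique_weight y (r + 1))"
    using sum_codegree_uncovered[OF y_nonneg y1, of s] sum_inner_weight[of s] s by (simp add: Z_def)
  also have "\<dots> \<le> 2 * (clique_weight y r + real s * (real (r + 1) * clique_weight y (r + 1)) - real r * (1 - real s * d) * clique_weight y r)
       + real r * (real (r + 1) * clique_weight y (r + 1))"
    using Z by simp
  also have "\<dots> = clique_weight y r * (2 * (1 - real r * (1 - real s * d)) + (2 * real s + real r) * (clique_density y (r + 1) / clique_density y r))"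
    unfolding rat2 by (simp add: algebra_simps add_divide_distrib)
  also have "\<dots> \<le> clique_weight y r * B"
  proof -
    have "(2 * real s + real r) * (clique_density y (r + 1) / clique_density y r) \<le> 3 * real r * (clique_density y (r + 1) / clique_density y r)"
      using clique_density_nonneg[of y "r+1", OF y_nonneg] hr s by (intro mult_right_mono) auto
    then show ?thesis using wr s by (intro mult_left_mono) (auto simp: B_def)
  qed
  finally have le: "(\<Sum>Q\<in>cliques r. prod y Q * F Q) \<le> (\<Sum>Q\<in>cliques r. prod y Q * B)"
    by (simp add: clique_weight_def sum_distrib_right)
  show ?thesis
  proof (rule ccontr)
    assume "\<not> ?thesis"
    then have lt: "F Q > B" if "Q \<in> cliques r" for Q using that by (auto simp: F_def B_def not_le)
    \<comment> \<open>The averages differ strictly only if some clique has nonzero weight; the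
      positive total weight supplies one.\<close>
    obtain Q where Q: "Q \<in> cliques r" "prod y Q \<noteq> 0"
      using wr sum.not_neutral_contains_not_neutral[of "prod y" "cliques r"] by (auto simp: clique_weight_def)
    have "(\<Sum>Q\<in>cliques r. prod y Q * B) < (\<Sum>Q\<in>cliques r. prod y Q * F Q)"
    proof (rule sum_strict_mono_ex1[OF finite_cliques])
      show "\<forall>Q\<in>cliques r. prod y Q * B \<le> prod y Q * F Q"
        by (intro ballI mult_left_mono nn lt[THEN less_imp_le])
      show "\<exists>Q\<in>cliques r. prod y Q * B < prod y Q * F Q"
        using Q lt nn[of Q] by (intro bexI[of _ Q] mult_strict_left_mono) auto
    qed
    with le show False by simp
  qed
qed

text \<open>A covered vertex is put into the class of some \<open>q\<close> in \<open>Q\<close> such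
  that it sees all of \<open>Q - {q}\<close>. An edge within a class then meets
  \<open>uncovered Q\<close> or lies inside some \<open>nbhd (Q - {q})\<close>. Pairs of the first
  kind, taken in both orders, weigh at most \<open>2 * sum y (uncovered Q)\<close>, so the total is
  the quantity bounded in \<open>exists_good_clique\<close>.\<close>

lemma exists_good_partition:
  assumes d: "clique_density y 2 = 1 - d" and d0: "d \<ge> 0" and r: "r \<ge> 2" and rd: "(real r - 1) * d < 1"
  shows "\<exists>f. (\<forall>v. f v < r) \<and> (\<Sum>(a,b)\<in>{(a,b). a \<in> V \<and> b \<in> V \<and> adj a b \<and> f a = f b}. y a * y b)
     \<le> 2 * (1 - real r * (1 - (real r - 1) * d)) + 3 * real r * (clique_density y (r + 1) / clique_density y r)"
proof -
  obtain Q where Q: "Q \<in> cliques r" and le: "2 * sum y (uncovered Q) + (\<Sum>v\<in>Q. inner_weight y (nbhd (Q - {v})))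
     \<le> 2 * (1 - real r * (1 - (real r - 1) * d)) + 3 * real r * (clique_density y (r + 1) / clique_density y r)"
    using exists_good_clique[OF assms] by blast
  have fQ: "finite Q" using Q by (rule finite_clique)
  obtain e where e: "bij_betw e Q {..<r}"
    using ex_bij_betw_finite_nat[OF fQ] clique_card[OF Q] by (auto simp: atLeast0LessThan)
  have Qne: "Q \<noteq> {}" using clique_card[OF Q] r by auto
  \<comment> \<open>Uncovered vertices get an arbitrary class, since all pairs containing them are
    charged to \<open>uncovered Q\<close> anyway.\<close>
  define c where "c v = (if v \<in> V - uncovered Q then SOME q. q \<in> Q \<and> v \<in> nbhd (Q - {q}) else SOME q. q \<in> Q)" for v
  have c1: "c v \<in> Q \<and> v \<in> nbhd (Q - {c v})" if "v \<in> V - uncovered Q" for v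
  proof -
    have "\<exists>q. q \<in> Q \<and> v \<in> nbhd (Q - {q})" using that by (auto simp: uncovered_def)
    from someI_ex[OF this] show ?thesis using that by (simp add: c_def)
  qed
  have cQ: "c v \<in> Q" for v
    using c1[of v] some_in_eq[of Q] Qne by (cases "v \<in> V - uncovered Q") (auto simp: c_def)
  define f where "f v = e (c v)" for v
  have fr: "f v < r" for v using e cQ[of v] by (auto simp: f_def bij_betw_def)
  have ff: "c a = c b" if "f a = f b" for a b
    using that e cQ by (auto simp: f_def bij_betw_def inj_on_def)
  let ?I = "\<lambda>q. {(a,b). a \<in> nbhd (Q - {q}) \<and> b \<in> nbhd (Q - {q}) \<and> adj a b}"
  let ?U = "uncovered Q"
  have U: "?U \<subseteq> V" by (auto simp: uncovered_def)
  have fU: "finite ?U" using U finite_V finite_subset by blast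
  have fI: "finite (?I q)" for q
    by (rule finite_subset[of _ "nbhd (Q - {q}) \<times> nbhd (Q - {q})"]) (auto simp: finite_nbhd)
  have yy: "(\<lambda>(a,b). y a * y b) x \<ge> 0" for x by (cases x) (simp add: y_nonneg)
  have sub: "{(a,b). a \<in> V \<and> b \<in> V \<and> adj a b \<and> f a = f b} \<subseteq> (?U \<times> V \<union> V \<times> ?U) \<union> (\<Union>q\<in>Q. ?I q)"
  proof
    fix x assume "x \<in> {(a,b). a \<in> V \<and> b \<in> V \<and> adj a b \<and> f a = f b}"
    then obtain a b where x: "x = (a,b)" and a: "a \<in> V" "b \<in> V" "adj a b" "f a = f b" by blast
    show "x \<in> (?U \<times> V \<union> V \<times> ?U) \<union> (\<Union>q\<in>Q. ?I q)"
    proof (cases "a \<in> ?U \<or> b \<in> ?U")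
      case True
      then show ?thesis using a x by blast
    next
      case False
      then have "(a,b) \<in> ?I (c a)" using c1[of a] c1[of b] ff[OF a(4)] a by simp
      then show ?thesis using cQ x by blast
    qed
  qed
  have "(\<Sum>(a,b)\<in>{(a,b). a \<in> V \<and> b \<in> V \<and> adj a b \<and> f a = f b}. y a * y b)
     \<le> (\<Sum>(a,b)\<in>(?U \<times> V \<union> V \<times> ?U) \<union> (\<Union>q\<in>Q. ?I q). y a * y b)"
    by (rule sum_mono2) (use sub fU fI fQ finite_V yy in auto)
  also have "\<dots> \<le> (\<Sum>(a,b)\<in>?U \<times> V \<union> V \<times> ?U. y a * y b) + (\<Sum>(a,b)\<in>(\<Union>q\<in>Q. ?I q). y a * y b)"
    using sum.union_inter[of "?U \<times> V \<union> V \<times> ?U" "\<Union>q\<in>Q. ?I q" "\<lambda>(a,b). y a * y b"]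
      sum_nonneg[of "(?U \<times> V \<union> V \<times> ?U) \<inter> (\<Union>q\<in>Q. ?I q)" "\<lambda>(a,b). y a * y b"] fU fI fQ finite_V yy
    by auto
  also have "(\<Sum>(a,b)\<in>?U \<times> V \<union> V \<times> ?U. y a * y b) \<le> (\<Sum>(a,b)\<in>?U \<times> V. y a * y b) + (\<Sum>(a,b)\<in>V \<times> ?U. y a * y b)"
    using sum.union_inter[of "?U \<times> V" "V \<times> ?U" "\<lambda>(a,b). y a * y b"]
      sum_nonneg[of "(?U \<times> V) \<inter> (V \<times> ?U)" "\<lambda>(a,b). y a * y b"] fU finite_V yy
    by auto
  also have "\<dots> = 2 * sum y ?U"
    by (simp add: sum.cartesian_product[symmetric] sum_distrib_left[symmetric] sum_distrib_right[symmetric] y1)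
  also have "(\<Sum>(a,b)\<in>(\<Union>q\<in>Q. ?I q). y a * y b) \<le> (\<Sum>q\<in>Q. \<Sum>(a,b)\<in>?I q. y a * y b)"
    by (rule sum_UN_le) (use fQ fI yy in auto)
  finally show ?thesis
    using le fr unfolding inner_weight_def by (intro exI[of _ f]) auto
qed

end

end

subsection \<open>Spectral radius and edge density\<close>

lemma eigen_sum:
  fixes A :: "'a :: comm_ring_1 mat"
  assumes A: "A \<in> carrier_mat n n" and v: "v \<in> carrier_vec n" and e: "A *\<^sub>v v = k \<cdot>\<^sub>v v" and i: "i < n"
  shows "(\<Sum>j<n. A $$ (i,j) * v $ j) = k * v $ i"
proof -
  have "(A *\<^sub>v v) $ i = (\<Sum>j<n. A $$ (i,j) * v $ j)"
    using A v i by (simp add: scalar_prod_def atLeast0LessThan)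
  then show ?thesis using e v i by simp
qed

text \<open>Needed because \<open>Max\<close> of an empty set of eigenvalues would be an unspecified number.\<close>

lemma real_symmetric_has_eigenvalue:
  fixes A :: "real mat"
  assumes A: "A \<in> carrier_mat n n" and n: "n > 0"
    and sym: "\<And>i j. i < n \<Longrightarrow> j < n \<Longrightarrow> A $$ (i,j) = A $$ (j,i)"
  shows "\<exists>k. eigenvalue A k"
proof -
  define B where "B = map_mat complex_of_real A"
  have B: "B \<in> carrier_mat n n" using A by (simp add: B_def)
  have Bij: "B $$ (i,j) = complex_of_real (A $$ (i,j))" if "i < n" "j < n" for i j
    using A that by (simp add: B_def)
  from spectrum_non_empty[OF B n] obtain k where "eigenvalue B k" by (auto simp: spectrum_def)
  then obtain v where v: "v \<in> carrier_vec n" "v \<noteq> 0\<^sub>v n" "B *\<^sub>v v = k \<cdot>\<^sub>v v"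
    using B by (auto simp: eigenvalue_def eigenvector_def)
  have row: "(\<Sum>j<n. B $$ (i,j) * v $ j) = k * v $ i" if "i < n" for i
    by (rule eigen_sum[OF B v(1,3) that])
  define S where "S = (\<Sum>i<n. (cmod (v $ i))\<^sup>2)"
  \<comment> \<open>The Hermitian form of \<open>B\<close> at \<open>v\<close>. It equals
    \<open>k\<close> times the squared norm of \<open>v\<close> and, by the symmetry of
    \<open>A\<close>, also its own conjugate; hence \<open>k\<close> is real.\<close>
  define X where "X = (\<Sum>i<n. \<Sum>j<n. cnj (v $ i) * (B $$ (i,j) * v $ j))"
  have "X = (\<Sum>i<n. cnj (v $ i) * (k * v $ i))"
    unfolding X_def by (intro sum.cong refl) (simp add: sum_distrib_left[symmetric] row)
  also have "\<dots> = (\<Sum>i<n. k * complex_of_real ((cmod (v $ i))\<^sup>2))"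
    by (intro sum.cong refl) (unfold complex_norm_square, simp add: mult_ac)
  also have "\<dots> = k * complex_of_real S" by (simp add: S_def sum_distrib_left)
  finally have X: "X = k * complex_of_real S" .
  have "cnj X = (\<Sum>i<n. \<Sum>j<n. v $ i * (B $$ (i,j) * cnj (v $ j)))"
    unfolding X_def by (auto simp: Bij intro!: sum.cong)
  also have "\<dots> = (\<Sum>j<n. \<Sum>i<n. v $ i * (B $$ (i,j) * cnj (v $ j)))" by (rule sum.swap)
  also have "\<dots> = X"
    unfolding X_def by (intro sum.cong refl) (auto simp: Bij sym mult_ac)
  finally have "cnj X = X" .
  then have "Im X = 0" by (metis complex_cnj_cancel_iff Im_complex_of_real Reals_cnj_iff complex_is_Real_iff)
  then have ImS: "Im k * S = 0" using X by simp
  obtain i0 where i0: "i0 < n" "v $ i0 \<noteq> 0"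
    using v(1,2) by (metis carrier_vecD dim_vec eq_vecI index_zero_vec(1) index_zero_vec(2))
  have "0 < (cmod (v $ i0))\<^sup>2" using i0 by simp
  also have "\<dots> \<le> S" unfolding S_def using i0 by (intro member_le_sum) auto
  finally have "Im k = 0" using ImS by simp
  \<comment> \<open>Since \<open>A\<close> and \<open>k\<close> are real, the real and imaginary
    parts of \<open>v\<close> each satisfy the eigenvalue equation, and at least one of them is
    nonzero.\<close>
  define x where "x = vec n (\<lambda>i. Re (v $ i))"
  define w where "w = vec n (\<lambda>i. Im (v $ i))"
  have mv: "(A *\<^sub>v u) $ i = (\<Sum>j<n. A $$ (i,j) * u $ j)" if "u \<in> carrier_vec n" "i < n" for u i
    using A that by (simp add: scalar_prod_def atLeast0LessThan)
  have re: "(\<Sum>j<n. A $$ (i,j) * Re (v $ j)) = Re k * Re (v $ i)" if "i < n" for i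
  proof -
    have "Re (\<Sum>j<n. B $$ (i,j) * v $ j) = Re (k * v $ i)" using row[OF that] by simp
    then show ?thesis using that \<open>Im k = 0\<close> by (simp add: Bij)
  qed
  have im: "(\<Sum>j<n. A $$ (i,j) * Im (v $ j)) = Re k * Im (v $ i)" if "i < n" for i
  proof -
    have "Im (\<Sum>j<n. B $$ (i,j) * v $ j) = Im (k * v $ i)" using row[OF that] by simp
    then show ?thesis using that \<open>Im k = 0\<close> by (simp add: Bij)
  qed
  have ex: "A *\<^sub>v x = Re k \<cdot>\<^sub>v x"
    by (rule eq_vecI) (use A re in \<open>auto simp: mv x_def simp del: index_mult_mat_vec\<close>)
  have ew: "A *\<^sub>v w = Re k \<cdot>\<^sub>v w"
    by (rule eq_vecI) (use A im in \<open>auto simp: mv w_def simp del: index_mult_mat_vec\<close>)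
  have "Re (v $ i0) \<noteq> 0 \<or> Im (v $ i0) \<noteq> 0" using i0 by (simp add: complex_eq_iff)
  then have "x \<noteq> 0\<^sub>v n \<or> w \<noteq> 0\<^sub>v n" using i0 by (metis index_vec index_zero_vec(1) x_def w_def)
  moreover have xw: "x \<in> carrier_vec n" "w \<in> carrier_vec n" by (auto simp: x_def w_def)
  ultimately have "eigenvalue A (Re k)"
    using ex ew A xw unfolding eigenvalue_def eigenvector_def by auto
  then show ?thesis by blast
qed

text \<open>The spectrum is finite and nonempty, so the maximum is attained; the eigenvector is then
  normalised. No sign is claimed for its entries, as their squares will serve as vertex
  weights.\<close>

lemma spec_radius_eigenvector:
  assumes n: "n > 0"
  shows "\<exists>x. (\<Sum>i<n. (x i)\<^sup>2) = 1 \<and>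
    (\<forall>i<n. (\<Sum>j<n. (if {i,j} \<in> E then 1 else 0) * x j) = spec_radius_graph n E * x i)"
proof -
  let ?A = "adj_matrix n E"
  define m where "m = spec_radius_graph n E"
  have A: "?A \<in> carrier_mat n n" by (simp add: adj_matrix_def)
  have "\<exists>k. eigenvalue ?A k"
    by (rule real_symmetric_has_eigenvalue[OF A n]) (simp add: adj_matrix_def insert_commute)
  moreover have "finite {k. eigenvalue ?A k}"
    using card_finite_spectrum(1)[OF A] by (simp add: spectrum_def)
  ultimately have "m \<in> {k. eigenvalue ?A k}"
    unfolding m_def spec_radius_graph_def by (intro Max_in) auto
  then obtain v where v: "v \<in> carrier_vec n" "v \<noteq> 0\<^sub>v n" "?A *\<^sub>v v = m \<cdot>\<^sub>v v"
    using A by (auto simp: eigenvalue_def eigenvector_def)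
  have row: "(\<Sum>j<n. (if {i,j} \<in> E then 1 else 0) * v $ j) = m * v $ i" if "i < n" for i
    using eigen_sum[OF A v(1,3) that] that by (simp add: adj_matrix_def)
  define S where "S = (\<Sum>i<n. (v $ i)\<^sup>2)"
  obtain i0 where i0: "i0 < n" "v $ i0 \<noteq> 0"
    using v(1,2) by (metis carrier_vecD dim_vec eq_vecI index_zero_vec(1) index_zero_vec(2))
  have "0 < (v $ i0)\<^sup>2" using i0 by simp
  also have "\<dots> \<le> S" unfolding S_def using i0 by (intro member_le_sum) auto
  finally have S: "S > 0" .
  show ?thesis
  proof (intro exI[of _ "\<lambda>i. v $ i / sqrt S"] conjI allI impI)
    show "(\<Sum>i<n. (v $ i / sqrt S)\<^sup>2) = 1"
      using S by (simp add: power_divide sum_divide_distrib[symmetric] S_def[symmetric])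
  next
    fix i assume "i < n"
    from row[OF this] have "(\<Sum>j<n. (if {i,j} \<in> E then 1 else 0) * v $ j) / sqrt S = m * v $ i / sqrt S"
      by simp
    then show "(\<Sum>j<n. (if {i,j} \<in> E then 1 else 0) * (v $ j / sqrt S)) = spec_radius_graph n E * (v $ i / sqrt S)"
      by (simp add: sum_divide_distrib m_def)
  qed
qed

lemma fin_graph_edges:
  assumes "graph_on n E"
  shows "fin_graph {..<n} (\<lambda>u v. {u,v} \<in> E)"
  using assms by unfold_locales (auto simp: graph_on_def insert_commute)

context fin_graph
begin

lemma clique_density_2:
  assumes y: "\<And>v. y v \<ge> 0"
  shows "clique_density y 2 = (\<Sum>a\<in>V. \<Sum>b\<in>V. (if adj a b then 1 else 0) * (y a * y b))"
proof -
  have "clique_density y 2 = (\<Sum>R\<in>cliques 1. prod y R * sum y (nbhd R))"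
    using clique_weight_Suc[of y 1, OF y] by (simp add: clique_density_def numeral_2_eq_2)
  also have "\<dots> = (\<Sum>a\<in>V. y a * sum y (nbhd {a}))"
    by (simp add: cliques_1 sum.reindex)
  also have "\<dots> = (\<Sum>a\<in>V. \<Sum>b\<in>V. (if adj a b then 1 else 0) * (y a * y b))"
  proof (rule sum.cong[OF refl])
    fix a
    have "sum y (nbhd {a}) = (\<Sum>b\<in>V. if adj a b then y b else 0)"
      unfolding nbhd_def using finite_V by (subst sum.inter_filter) auto
    then show "y a * sum y (nbhd {a}) = (\<Sum>b\<in>V. (if adj a b then 1 else 0) * (y a * y b))"
      by (auto simp: sum_distrib_left intro!: sum.cong)
  qed
  finally show ?thesis .
qed

lemma clique_density_uniform: "clique_density (\<lambda>_. 1 / c) s = fact s * real (card (cliques s)) / c ^ s"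
  by (simp add: clique_density_def clique_weight_def clique_card power_divide)

text \<open>Weights at most \<open>b\<close> times the uniform ones enlarge each monomial by at most
  \<open>b ^ s\<close>.\<close>

lemma clique_density_le_uniform:
  assumes y: "\<And>v. y v \<ge> 0" and b: "\<And>v. v \<in> V \<Longrightarrow> y v \<le> b / c" and "b \<ge> 0" "c > 0"
  shows "clique_density y s \<le> b ^ s * clique_density (\<lambda>_. 1 / c) s"
proof -
  have "clique_weight y s \<le> (\<Sum>K\<in>cliques s. (b / c) ^ s)"
    unfolding clique_weight_def
  proof (rule sum_mono)
    fix K assume K: "K \<in> cliques s"
    have "prod y K \<le> (\<Prod>v\<in>K. b / c)"
      using clique_subset[OF K] by (intro prod_mono) (auto intro: y b)
    then show "prod y K \<le> (b / c) ^ s" using clique_card[OF K] by simp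
  qed
  then have "fact s * clique_weight y s \<le> fact s * (\<Sum>K\<in>cliques s. (b / c) ^ s)" by (intro mult_left_mono) auto
  then show ?thesis unfolding clique_density_uniform by (simp add: clique_density_def power_divide field_simps)
qed

text \<open>The eigenvalue \<open>m\<close> is the quadratic form of the adjacency matrix at
  \<open>x\<close>. Cauchy--Schwarz over ordered adjacent pairs bounds \<open>m\<^sup>2\<close> by
  \<open>n\<^sup>2\<close> times the uniform edge density times the edge density for the weights
  \<open>x\<^sup>2\<close>, and \<open>motzkin_straus_robust\<close> controls the last factor. The
  power of 5 is the price of passing from eigenvector weights to uniform ones.\<close>

lemma spectral_edge_density:
  fixes x :: "'a \<Rightarrow> real"
  assumes x1: "(\<Sum>i\<in>V. (x i)\<^sup>2) = 1"
    and ev: "\<And>i. i \<in> V \<Longrightarrow> (\<Sum>j\<in>V. (if adj i j then 1 else 0) * x j) = m * x i"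
    and r: "r \<ge> 2" and n: "n = real (card V)" "n > 0" and \<epsilon>: "0 \<le> \<epsilon>" "\<epsilon> \<le> 1 / 100"
    and m: "m > (1 - 1 / real r - \<epsilon>) * n"
  shows "clique_density (\<lambda>_. 1 / n) 2 \<ge> 1 - 1 / real r - 2 * \<epsilon> - real r ^ r * 5 ^ (r + 1) * clique_density (\<lambda>_. 1 / n) (r + 1)"
proof -
  define a where "a = 1 - 1 / real r"
  have a: "1 / 2 \<le> a" "a \<le> 1" using r by (auto simp: a_def field_simps)
  have ae: "a - \<epsilon> \<ge> 49 / 100" using a \<epsilon> by linarith
  define y where "y i = (x i)\<^sup>2" for i
  have y: "y i \<ge> 0" for i by (simp add: y_def)
  have y1: "sum y V = 1" using x1 by (simp add: y_def)
  have m': "m > (a - \<epsilon>) * n" using m by (simp add: a_def)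
  define A where "A i j = (if adj i j then 1 else (0::real))" for i j
  have AA: "A i j * A i j = A i j" for i j by (auto simp: A_def)
  have ev': "(\<Sum>j\<in>V. A i j * x j) = m * x i" if "i \<in> V" for i
    using ev[OF that] by (simp add: A_def)
  \<comment> \<open>Cauchy--Schwarz in row \<open>i\<close> gives
    \<open>(m * x i)\<^sup>2 \<le> n\<close>; moreover \<open>m > 0.49 * n\<close>, and
    \<open>0.49\<^sup>2 > 1/5\<close>.\<close>
  have yb: "y i \<le> 5 / n" if i: "i \<in> V" for i
  proof -
    have "(m * x i)\<^sup>2 = (\<Sum>j\<in>V. A i j * x j)\<^sup>2" using ev'[OF i] by simp
    also have "\<dots> \<le> (\<Sum>j\<in>V. (A i j)\<^sup>2) * (\<Sum>j\<in>V. (x j)\<^sup>2)" by (rule Cauchy_Schwarz_ineq_sum)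
    also have "\<dots> \<le> n"
    proof -
      have "(\<Sum>j\<in>V. (A i j)\<^sup>2) \<le> (\<Sum>j\<in>V. 1)" by (rule sum_mono) (auto simp: A_def)
      then show ?thesis using x1 n by simp
    qed
    finally have 1: "m\<^sup>2 * y i \<le> n" by (simp add: y_def power_mult_distrib)
    have "n\<^sup>2 / 5 \<le> (49/100)\<^sup>2 * n\<^sup>2" by (simp add: power2_eq_square)
    also have "\<dots> \<le> ((a - \<epsilon>) * n)\<^sup>2"
      unfolding power_mult_distrib using ae by (intro mult_right_mono power_mono) auto
    also have "\<dots> \<le> m\<^sup>2" using m' ae n by (intro power_mono) auto
    finally have "n\<^sup>2 / 5 * y i \<le> m\<^sup>2 * y i" using y by (intro mult_right_mono) auto
    with 1 have "n\<^sup>2 / 5 * y i \<le> n" by linarith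
    then have "n * (n * y i) \<le> n * 5" by (simp add: power2_eq_square mult.assoc)
    then have "n * y i \<le> 5" using n by (simp add: mult_le_cancel_left_pos)
    then show ?thesis using n by (simp add: field_simps)
  qed
  define t where "t = real r ^ r * 5 ^ (r + 1) * clique_density (\<lambda>_. 1 / n) (r + 1)"
  define d where "d = clique_density (\<lambda>_. 1 / n) 2"
  have t0: "t \<ge> 0" unfolding t_def using clique_density_nonneg[of "\<lambda>_. 1 / n" "r+1"] n by simp
  have "clique_density y (r + 1) \<le> 5 ^ (r + 1) * clique_density (\<lambda>_. 1 / n) (r + 1)"
    by (rule clique_density_le_uniform[OF y yb]) (use n in auto)
  then have "real r ^ r * clique_density y (r + 1) \<le> t" unfolding t_def mult.assoc by (intro mult_left_mono) auto
  then have hy: "clique_density y 2 \<le> a + t"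
    using motzkin_straus_robust[of y, OF y y1 r] by (simp add: a_def)
  have nd: "n\<^sup>2 * d = (\<Sum>i\<in>V. \<Sum>j\<in>V. A i j)"
    unfolding d_def using n by (subst clique_density_2) (auto simp: A_def sum_distrib_left power2_eq_square intro!: sum.cong)
  have d0: "d \<ge> 0" unfolding d_def using n clique_density_nonneg[of "\<lambda>_. 1/n" 2] by simp
  have "m = (\<Sum>i\<in>V. x i * (m * x i))"
    using x1 by (simp add: power2_eq_square sum_distrib_left[symmetric] mult.left_commute)
  also have "\<dots> = (\<Sum>i\<in>V. \<Sum>j\<in>V. A i j * (x i * x j))"
    by (auto simp: ev'[symmetric] sum_distrib_left mult_ac intro!: sum.cong)
  \<comment> \<open>A 0/1 entry equals its own square; splitting it lets Cauchy--Schwarz see only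
    the adjacent pairs.\<close>
  also have "\<dots> = (\<Sum>p\<in>V \<times> V. (A (fst p) (snd p)) * (A (fst p) (snd p) * (x (fst p) * x (snd p))))"
    by (simp add: sum.cartesian_product split_beta AA mult.assoc[symmetric])
  finally have "m\<^sup>2 = (\<Sum>p\<in>V \<times> V. (A (fst p) (snd p)) * (A (fst p) (snd p) * (x (fst p) * x (snd p))))\<^sup>2"
    by simp
  also have "\<dots> \<le> (\<Sum>p\<in>V \<times> V. (A (fst p) (snd p))\<^sup>2) * (\<Sum>p\<in>V \<times> V. (A (fst p) (snd p) * (x (fst p) * x (snd p)))\<^sup>2)"
    by (rule Cauchy_Schwarz_ineq_sum)
  also have "(\<Sum>p\<in>V \<times> V. (A (fst p) (snd p))\<^sup>2) = n\<^sup>2 * d"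
    unfolding nd by (simp add: sum.cartesian_product split_beta power2_eq_square AA)
  also have "(\<Sum>p\<in>V \<times> V. (A (fst p) (snd p) * (x (fst p) * x (snd p)))\<^sup>2) = clique_density y 2"
    unfolding clique_density_2[OF y] A_def[symmetric] y_def
    by (simp add: sum.cartesian_product split_beta power_mult_distrib) (simp add: power2_eq_square AA)
  finally have "m\<^sup>2 \<le> n\<^sup>2 * d * clique_density y 2" .
  also have "\<dots> \<le> n\<^sup>2 * d * (a + t)" using hy d0 by (intro mult_left_mono) auto
  finally have "m\<^sup>2 \<le> n\<^sup>2 * (d * (a + t))" by (simp add: mult.assoc)
  moreover have "((a - \<epsilon>) * n)\<^sup>2 \<le> m\<^sup>2" using m' ae n by (intro power_mono) auto
  ultimately have "n\<^sup>2 * (a - \<epsilon>)\<^sup>2 \<le> n\<^sup>2 * (d * (a + t))" by (simp add: power_mult_distrib mult.commute)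
  then have main: "(a - \<epsilon>)\<^sup>2 \<le> d * (a + t)" using n by (simp add: mult_le_cancel_left_pos)
  \<comment> \<open>The desired lower bound on \<open>d\<close>, multiplied by \<open>a + t\<close>,
    stays below \<open>(a - \<epsilon>)\<^sup>2\<close>; the positive factor \<open>a + t\<close>
    then cancels against \<open>main\<close>.\<close>
  have "(a - 2 * \<epsilon> - t) * (a + t) \<le> (a - \<epsilon>)\<^sup>2"
  proof -
    have "(a - \<epsilon>)\<^sup>2 - (a - 2 * \<epsilon> - t) * (a + t) = \<epsilon>\<^sup>2 + 2 * \<epsilon> * t + t\<^sup>2"
      by (simp add: power2_eq_square algebra_simps)
    also have "\<dots> \<ge> 0" using \<epsilon> t0 by simp
    finally show ?thesis by simp
  qed
  with main have "(a - 2 * \<epsilon> - t) * (a + t) \<le> d * (a + t)" by linarith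
  then have "a - 2 * \<epsilon> - t \<le> d" using a t0 by (simp add: mult_le_cancel_right)
  then show ?thesis by (simp add: a_def d_def t_def)
qed

end

subsection \<open>Complete multipartite subgraphs from many cliques\<close>

context fin_graph
begin

text \<open>Ordered cliques: as \<open>adj\<close> is symmetric and irreflexive,
  \<open>sorted_wrt adj\<close> makes the entries pairwise adjacent and distinct. The position of a
  vertex in the list later names the part it belongs to.\<close>

definition clique_lists :: "nat \<Rightarrow> 'a list set" where
  "clique_lists k = {xs. length xs = k \<and> set xs \<subseteq> V \<and> sorted_wrt adj xs}"

lemma finite_clique_lists: "finite (clique_lists k)"
  by (rule finite_subset[OF _ finite_lists_length_eq[OF finite_V, of k]]) (auto simp: clique_lists_def)

lemma card_clique_lists_ge: "fact k * card (cliques k) \<le> card (clique_lists k)"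
proof -
  have "card (\<Union>K\<in>cliques k. permutations_of_set K) = (\<Sum>K\<in>cliques k. card (permutations_of_set K))"
    by (rule card_UN_disjoint) (auto simp: finite_cliques dest: permutations_of_setD)
  also have "\<dots> = (\<Sum>K\<in>cliques k. fact k)"
    by (intro sum.cong refl) (auto simp: finite_clique clique_card)
  finally have "card (\<Union>K\<in>cliques k. permutations_of_set K) = fact k * card (cliques k)"
    by simp
  moreover have "(\<Union>K\<in>cliques k. permutations_of_set K) \<subseteq> clique_lists k"
  proof clarify
    fix K xs assume K: "K \<in> cliques k" and xs: "xs \<in> permutations_of_set K"
    then have s: "set xs = K" "distinct xs" by (auto simp: permutations_of_set_def)
    then have "length xs = k" using K by (metis clique_card distinct_card)
    moreover have "sorted_wrt adj xs"
      unfolding sorted_wrt_iff_nth_less using s K by (auto simp: cliques_def nth_eq_iff_index_eq)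
    ultimately show "xs \<in> clique_lists k" using s K by (auto simp: clique_lists_def cliques_def)
  qed
  ultimately show ?thesis by (metis card_mono finite_clique_lists)
qed

text \<open>The position classes of an aligned family span a complete \<open>k\<close>-partite graph.\<close>

definition aligned :: "nat \<Rightarrow> 'a list set \<Rightarrow> bool" where
  "aligned k F \<longleftrightarrow> (\<forall>xs\<in>F. \<forall>ys\<in>F. \<forall>p<k. \<forall>q<k. p \<noteq> q \<longrightarrow> adj (xs ! p) (ys ! q)) \<and>
     (\<forall>p<k. inj_on (\<lambda>xs. xs ! p) F)"

lemma aligned_subset: "aligned k F \<Longrightarrow> F' \<subseteq> F \<Longrightarrow> aligned k F'"
  unfolding aligned_def by (meson inj_on_subset subsetD)

text \<open>Double counting of pairs (vertex, extended list) shows that at least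
  \<open>card V / N\<close> vertices extend at least \<open>s\<close> of the \<open>s * N\<close>
  lists in \<open>F\<close>. Each such vertex selects \<open>s\<close> of the lists it extends, and
  by pigeonhole at least \<open>t\<close> vertices select the same ones.\<close>

lemma common_extension:
  assumes F: "finite F" "card F = s * N" and N: "N > 0" and s: "s > 0"
    and heavy: "\<And>R. R \<in> F \<Longrightarrow> N * card {v \<in> V. v # R \<in> M} \<ge> 2 * card V"
    and t: "t * 2 ^ (s * N) * N \<le> card V" and V0: "card V > 0"
  shows "\<exists>F' T. F' \<subseteq> F \<and> card F' = s \<and> T \<subseteq> V \<and> card T = t \<and> (\<forall>v\<in>T. \<forall>R\<in>F'. v # R \<in> M)"
proof -
  define n where "n = card V"
  define B where "B v = {R \<in> F. v # R \<in> M}" for v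
  define G where "G = {v \<in> V. card (B v) \<ge> s}"
  have fG: "finite G" using finite_V by (simp add: G_def)
  have "(\<Sum>v\<in>V. card (B v)) = (\<Sum>R\<in>F. card {v \<in> V. v # R \<in> M})"
    unfolding B_def by (rule sum_multicount_gen) (use F finite_V in auto)
  then have "N * (\<Sum>v\<in>V. card (B v)) = (\<Sum>R\<in>F. N * card {v \<in> V. v # R \<in> M})"
    by (simp add: sum_distrib_left)
  also have "\<dots> \<ge> (\<Sum>R\<in>F. 2 * n)"
    using heavy by (intro sum_mono) (auto simp: n_def)
  finally have low: "N * (\<Sum>v\<in>V. card (B v)) \<ge> s * N * (2 * n)" using F by simp
  have "(\<Sum>v\<in>V. card (B v)) = (\<Sum>v\<in>G. card (B v)) + (\<Sum>v\<in>V - G. card (B v))"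
    by (subst add.commute, rule sum.subset_diff) (use finite_V in \<open>auto simp: G_def\<close>)
  also have "(\<Sum>v\<in>G. card (B v)) \<le> (\<Sum>v\<in>G. s * N)"
    using F by (intro sum_mono) (metis (no_types, lifting) B_def card_mono mem_Collect_eq subsetI)
  also have "(\<Sum>v\<in>V - G. card (B v)) \<le> (\<Sum>v\<in>V. s)"
  proof -
    have "(\<Sum>v\<in>V - G. card (B v)) \<le> (\<Sum>v\<in>V - G. s)" by (intro sum_mono) (auto simp: G_def)
    also have "\<dots> \<le> (\<Sum>v\<in>V. s)" by (rule sum_mono2) (use finite_V in auto)
    finally show ?thesis .
  qed
  finally have "(\<Sum>v\<in>V. card (B v)) \<le> card G * (s * N) + n * s" by (simp add: n_def)
  then have "N * (\<Sum>v\<in>V. card (B v)) \<le> N * (card G * (s * N) + n * s)" by simp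
  with low have "s * N * (2 * n) \<le> N * (card G * (s * N) + n * s)" by linarith
  also have "\<dots> = s * N * (card G * N + n)" by (simp add: algebra_simps)
  finally have "2 * n \<le> card G * N + n" using s N by simp
  then have G: "n \<le> card G * N" by simp
  have "\<exists>S. S \<subseteq> B v \<and> card S = s" if "v \<in> G" for v
    using that obtain_subset_with_card_n[of s "B v"] by (auto simp: G_def)
  then obtain \<phi> where \<phi>: "\<And>v. v \<in> G \<Longrightarrow> \<phi> v \<subseteq> B v \<and> card (\<phi> v) = s" by metis
  have G0: "G \<noteq> {}" using G V0 N by (auto simp: n_def)
  have "\<phi> \<in> G \<rightarrow> Pow F" using \<phi> by (fastforce simp: B_def)
  \<comment> \<open>Pigeonhole over the \<open>2 ^ (s * N)\<close> subsets of
    \<open>F\<close>.\<close>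
  have "\<exists>S\<in>Pow F. card G \<le> card (\<phi> -` {S} \<inter> G) * card (Pow F)"
  proof (rule ccontr)
    assume "\<not> ?thesis"
    then have lt: "card (\<phi> -` {S} \<inter> G) * card (Pow F) < card G" if "S \<in> Pow F" for S
      using that by (auto simp: not_le)
    have "G = (\<Union>S\<in>Pow F. \<phi> -` {S} \<inter> G)" using \<open>\<phi> \<in> G \<rightarrow> Pow F\<close> by auto
    then have "card G \<le> (\<Sum>S\<in>Pow F. card (\<phi> -` {S} \<inter> G))"
      using card_UN_le[of "Pow F" "\<lambda>S. \<phi> -` {S} \<inter> G"] F by simp
    then have "card G * card (Pow F) \<le> (\<Sum>S\<in>Pow F. card (\<phi> -` {S} \<inter> G)) * card (Pow F)" by simp
    also have "\<dots> = (\<Sum>S\<in>Pow F. card (\<phi> -` {S} \<inter> G) * card (Pow F))" by (simp add: sum_distrib_right)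
    also have "\<dots> < (\<Sum>S\<in>Pow F. card G)" by (rule sum_strict_mono) (use F lt in auto)
    also have "\<dots> = card G * card (Pow F)" by simp
    finally show False by simp
  qed
  then obtain S where S: "S \<in> Pow F" "card G \<le> card (\<phi> -` {S} \<inter> G) * card (Pow F)" by blast
  let ?T = "\<phi> -` {S} \<inter> G"
  have c2: "card (Pow F) = 2 ^ (s * N)" using F by (simp add: card_Pow)
  have "t * 2 ^ (s * N) * N \<le> card G * N" using t G unfolding n_def by linarith
  also have "\<dots> \<le> card ?T * 2 ^ (s * N) * N" using S c2 by simp
  finally have "t \<le> card ?T" using N by simp
  then obtain T where T: "T \<subseteq> ?T" "card T = t" by (meson obtain_subset_with_card_n)
  \<comment> \<open>A nonempty fibre shows that \<open>S\<close> is a value of \<open>\<phi>\<close>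
    and so has exactly \<open>s\<close> elements; \<open>T\<close> itself would be empty for
    \<open>t = 0\<close>.\<close>
  have "card ?T \<noteq> 0" using S G0 fG by auto
  then obtain v0 where "v0 \<in> ?T" using card.empty by (metis all_not_in_conv)
  then have "card S = s" using \<phi> by auto
  moreover have "v # R \<in> M" if "v \<in> T" "R \<in> S" for v R
  proof -
    have "v \<in> G" "\<phi> v = S" using that T by auto
    then show ?thesis using \<phi>[of v] that by (auto simp: B_def)
  qed
  ultimately show ?thesis using S T by (intro exI[of _ S] exI[of _ T]) (auto simp: G_def)
qed

text \<open>Lists with a light tail make up at most half of the assumed lower bound on
  \<open>card M\<close>, and a heavy tail has at most \<open>card V\<close> extensions. The bound
  loses one factor 2 for each position removed, and its form \<open>2 ^ k\<close> leaves a factor of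
  at least 2 at every later stage with \<open>k \<ge> 1\<close>.\<close>

lemma heavy_lists:
  assumes M: "M \<subseteq> clique_lists (Suc k)" and big: "2 ^ Suc k * card V ^ Suc k \<le> N * card M"
    and V0: "card V > 0"
  shows "2 ^ k * card V ^ k \<le> N * card {R \<in> clique_lists k. N * card {v \<in> V. v # R \<in> M} \<ge> 2 ^ k * card V}"
    (is "_ \<le> N * card ?L")
proof -
  define n where "n = card V"
  define d where "d R = card {v \<in> V. v # R \<in> M}" for R
  have "M \<subseteq> (\<lambda>(R,v). v # R) ` (Sigma (clique_lists k) (\<lambda>R. {v \<in> V. v # R \<in> M}))"
  proof
    fix xs assume x: "xs \<in> M"
    then have "xs \<in> clique_lists (Suc k)" using M by blast
    then obtain v R where "xs = v # R" "v \<in> V" "R \<in> clique_lists k"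
      by (auto simp: clique_lists_def length_Suc_conv)
    then show "xs \<in> (\<lambda>(R,v). v # R) ` (Sigma (clique_lists k) (\<lambda>R. {v \<in> V. v # R \<in> M}))"
      using x by (intro image_eqI[of _ _ "(R,v)"]) auto
  qed
  then have "card M \<le> card (Sigma (clique_lists k) (\<lambda>R. {v \<in> V. v # R \<in> M}))"
    by (rule surj_card_le[rotated]) (simp add: finite_clique_lists finite_V)
  also have "\<dots> = (\<Sum>R\<in>clique_lists k. d R)"
    by (subst card_SigmaI) (auto simp: finite_clique_lists finite_V d_def)
  finally have "N * card M \<le> (\<Sum>R\<in>clique_lists k. N * d R)" by (simp add: sum_distrib_left[symmetric])
  also have "\<dots> = (\<Sum>R\<in>?L. N * d R) + (\<Sum>R\<in>clique_lists k - ?L. N * d R)"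
    by (subst add.commute, rule sum.subset_diff) (auto simp: finite_clique_lists)
  also have "(\<Sum>R\<in>?L. N * d R) \<le> (\<Sum>R\<in>?L. N * n)"
    by (intro sum_mono mult_left_mono) (auto simp: d_def n_def finite_V intro!: card_mono)
  also have "(\<Sum>R\<in>clique_lists k - ?L. N * d R) \<le> (\<Sum>R\<in>clique_lists k. 2 ^ k * n)"
  proof -
    have "(\<Sum>R\<in>clique_lists k - ?L. N * d R) \<le> (\<Sum>R\<in>clique_lists k - ?L. 2 ^ k * n)"
      by (intro sum_mono) (auto simp: d_def n_def)
    also have "\<dots> \<le> (\<Sum>R\<in>clique_lists k. 2 ^ k * n)" by (rule sum_mono2) (auto simp: finite_clique_lists)
    finally show ?thesis .
  qed
  finally have 1: "N * card M \<le> card ?L * (N * n) + card (clique_lists k) * (2 ^ k * n)" by simp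
  have "card (clique_lists k) \<le> card {xs. set xs \<subseteq> V \<and> length xs = k}"
    by (rule card_mono) (auto simp: finite_lists_length_eq[OF finite_V] clique_lists_def)
  then have "card (clique_lists k) \<le> n ^ k" by (simp add: card_lists_length_eq[OF finite_V] n_def)
  then have "card (clique_lists k) * (2 ^ k * n) \<le> n ^ k * (2 ^ k * n)" by simp
  with 1 big have "2 ^ Suc k * n ^ Suc k \<le> card ?L * (N * n) + n ^ k * (2 ^ k * n)"
    unfolding n_def by linarith
  then have "n * (2 ^ k * n ^ k) \<le> n * (N * card ?L)" by (simp add: algebra_simps)
  then show ?thesis using V0 by (simp add: n_def)
qed

text \<open>Induction on the length of the lists: among the heavy tails an aligned family of size
  \<open>s * N\<close> is found first, then \<open>common_extension\<close> keeps \<open>s\<close>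
  of its members together with \<open>s\<close> common extensions. The required size thus grows by a
  factor \<open>N\<close> per position, which explains \<open>s * N ^ (k - 1)\<close>.\<close>

lemma aligned_family:
  assumes N: "N > 0" and V0: "card V > 0"
  shows "M \<subseteq> clique_lists k \<Longrightarrow> k \<ge> 1 \<Longrightarrow> 2 ^ k * card V ^ k \<le> N * card M \<Longrightarrow> s > 0 \<Longrightarrow>
    N * 2 ^ (s * N ^ (k - 1)) * (s * N ^ (k - 1)) \<le> card V \<Longrightarrow>
    \<exists>F. F \<subseteq> M \<and> card F = s \<and> aligned k F"
proof (induction k arbitrary: M s)
  case 0
  then show ?case by simp
next
  case (Suc k)
  show ?case
  proof (cases "k = 0")
    case True
    have "N * s \<le> N * 2 ^ s * s" by simp
    also have "\<dots> \<le> card V" using Suc.prems True by simp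
    also have "\<dots> \<le> N * card M" using Suc.prems True by simp
    finally have "s \<le> card M" using N by simp
    then obtain F where F: "F \<subseteq> M" "card F = s" by (meson obtain_subset_with_card_n)
    have "inj_on (\<lambda>xs. xs ! 0) F"
    proof (rule inj_onI)
      fix xs ys assume "xs \<in> F" "ys \<in> F" and e: "xs ! 0 = ys ! 0"
      then have "length xs = 1" "length ys = 1" using F Suc.prems True by (auto simp: clique_lists_def)
      then show "xs = ys" using e by (auto simp: length_Suc_conv)
    qed
    then show ?thesis using F True by (intro exI[of _ F]) (auto simp: aligned_def)
  next
    case False
    let ?L = "{R \<in> clique_lists k. N * card {v \<in> V. v # R \<in> M} \<ge> 2 ^ k * card V}"
    have e: "s * N * N ^ (k - 1) = s * N ^ k" using False by (cases k) auto
    have sz: "N * 2 ^ (s * N ^ k) * (s * N ^ k) \<le> card V" using Suc.prems by simp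
    have "\<exists>F. F \<subseteq> ?L \<and> card F = s * N \<and> aligned k F"
    proof (rule Suc.IH)
      show "2 ^ k * card V ^ k \<le> N * card ?L" by (rule heavy_lists[OF Suc.prems(1,3) V0])
      show "N * 2 ^ (s * N * N ^ (k - 1)) * (s * N * N ^ (k - 1)) \<le> card V" unfolding e by (rule sz)
    qed (use False Suc.prems N in auto)
    then obtain F where F: "F \<subseteq> ?L" "card F = s * N" "aligned k F" by blast
    have fF: "finite F" using F N Suc.prems by (metis card.infinite mult_is_0 not_gr_zero)
    have Nk: "N \<le> N ^ k" using False N by (simp add: self_le_power)
    have "\<exists>F' T. F' \<subseteq> F \<and> card F' = s \<and> T \<subseteq> V \<and> card T = s \<and> (\<forall>v\<in>T. \<forall>R\<in>F'. v # R \<in> M)"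
    proof (rule common_extension[OF fF F(2) N Suc.prems(4) _ _ V0])
      fix R assume "R \<in> F"
      then have "N * card {v \<in> V. v # R \<in> M} \<ge> 2 ^ k * card V" using F by auto
      moreover have "(2::nat) ^ 1 \<le> 2 ^ k" using False by (intro power_increasing) auto
      then have "2 * card V \<le> 2 ^ k * card V" by simp
      ultimately show "N * card {v \<in> V. v # R \<in> M} \<ge> 2 * card V" by linarith
    next
      have "s * 2 ^ (s * N) * N \<le> (s * N ^ k) * 2 ^ (s * N ^ k) * N"
        using Nk N by (intro mult_mono power_increasing) auto
      also have "\<dots> \<le> card V" using sz by (simp add: mult_ac)
      finally show "s * 2 ^ (s * N) * N \<le> card V" .
    qed
    then obtain F' T where FT: "F' \<subseteq> F" "card F' = s" "T \<subseteq> V" "card T = s"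
      "\<And>v R. v \<in> T \<Longrightarrow> R \<in> F' \<Longrightarrow> v # R \<in> M" by blast
    have al: "aligned k F'" using aligned_subset[OF F(3) FT(1)] .
    have "finite F'" "finite T" using fF FT finite_V finite_subset by blast+
    \<comment> \<open>Every vertex of \<open>T\<close> extends every list of \<open>F'\<close>, so
      an arbitrary bijection may decide which vertex is prepended to which list; its injectivity
      makes the new first entries distinct.\<close>
    then obtain h where h: "bij_betw h F' T" using FT finite_same_card_bij by metis
    have hT: "h R \<in> T" if "R \<in> F'" for R using h that by (auto simp: bij_betw_def)
    have adjh: "adj v (R ! q)" if "v \<in> T" "R \<in> F'" "q < k" for v R q
    proof -
      have "v # R \<in> clique_lists (Suc k)" using FT(5)[OF that(1,2)] Suc.prems(1) by blast
      then show ?thesis using that(3) by (auto simp: clique_lists_def)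
    qed
    define E where "E = (\<lambda>R. h R # R) ` F'"
    have "inj_on (\<lambda>R. h R # R) F'" by (auto simp: inj_on_def)
    then have "card E = s" using FT by (simp add: E_def card_image)
    moreover have "E \<subseteq> M" using FT(5) hT by (auto simp: E_def)
    moreover have "aligned (Suc k) E"
      unfolding aligned_def
    proof (intro conjI ballI allI impI)
      fix xs ys p q assume "xs \<in> E" "ys \<in> E" and pq: "p < Suc k" "q < Suc k" "p \<noteq> q"
      then obtain R R' where R: "R \<in> F'" "R' \<in> F'" "xs = h R # R" "ys = h R' # R'" by (auto simp: E_def)
      show "adj (xs ! p) (ys ! q)"
      proof (cases p)
        case 0
        then obtain q' where "q = Suc q'" "q' < k" using pq by (cases q) auto
        then show ?thesis using 0 R adjh[OF hT] by simp
      next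
        case (Suc p')
        show ?thesis
        proof (cases q)
          case 0
          then show ?thesis using Suc pq R adjh[OF hT[of R'], of R p'] adj_sym by simp
        next
          case (Suc q')
          then show ?thesis using \<open>p = Suc p'\<close> pq R al by (auto simp: aligned_def)
        qed
      qed
    next
      fix p assume p: "p < Suc k"
      show "inj_on (\<lambda>xs. xs ! p) E"
      proof (cases p)
        case 0
        then show ?thesis using h by (auto simp: E_def inj_on_def bij_betw_def)
      next
        case (Suc p')
        then have "inj_on (\<lambda>xs. xs ! p') F'" using al p by (auto simp: aligned_def)
        then show ?thesis using Suc by (auto simp: E_def inj_on_def)
      qed
    qed
    ultimately show ?thesis by blast
  qed
qed

text \<open>The last part is split off from the induction: an aligned family of
  \<open>r\<close>-lists supplies the first \<open>r\<close> parts, and a final use of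
  \<open>common_extension\<close> with \<open>t\<close> in place of \<open>s\<close> allows the
  remaining part to be much larger.\<close>

lemma complete_multipartite_of_many_cliques:
  assumes N: "N > 0" and V0: "card V > 0" and r: "r \<ge> 1" and s: "s > 0"
    and big: "2 ^ Suc r * card V ^ Suc r \<le> N * (fact (Suc r) * card (cliques (Suc r)))"
    and sz: "N * 2 ^ (s * N ^ r) * (s * N ^ r) \<le> card V"
    and t: "t * 2 ^ (s * N) * N \<le> card V"
  shows "\<exists>W. (\<forall>i<r + 1. W i \<subseteq> V \<and> card (W i) = (if i < r then s else t)) \<and>
       (\<forall>i<r + 1. \<forall>j<r + 1. i \<noteq> j \<longrightarrow> (\<forall>x\<in>W i. \<forall>y\<in>W j. adj x y))"
proof -
  define M where "M = clique_lists (Suc r)"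
  have bM: "2 ^ Suc r * card V ^ Suc r \<le> N * card M"
    using big mult_le_mono2[OF card_clique_lists_ge[of "Suc r"], of N] unfolding M_def by linarith
  let ?L = "{R \<in> clique_lists r. N * card {v \<in> V. v # R \<in> M} \<ge> 2 ^ r * card V}"
  have e: "s * N * N ^ (r - 1) = s * N ^ r" using r by (cases r) auto
  have "\<exists>F. F \<subseteq> ?L \<and> card F = s * N \<and> aligned r F"
  proof (rule aligned_family[OF N V0])
    show "2 ^ r * card V ^ r \<le> N * card ?L" by (rule heavy_lists[OF _ bM V0]) (simp add: M_def)
    show "N * 2 ^ (s * N * N ^ (r - 1)) * (s * N * N ^ (r - 1)) \<le> card V" unfolding e by (rule sz)
  qed (use r s N in auto)
  then obtain F where F: "F \<subseteq> ?L" "card F = s * N" "aligned r F" by blast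
  have fF: "finite F" using F N s by (metis card.infinite mult_is_0 not_gr_zero)
  have "\<exists>F' T. F' \<subseteq> F \<and> card F' = s \<and> T \<subseteq> V \<and> card T = t \<and> (\<forall>v\<in>T. \<forall>R\<in>F'. v # R \<in> M)"
  proof (rule common_extension[OF fF F(2) N s _ t V0])
    fix R assume "R \<in> F"
    then have "N * card {v \<in> V. v # R \<in> M} \<ge> 2 ^ r * card V" using F by auto
    moreover have "(2::nat) ^ 1 \<le> 2 ^ r" using r by (intro power_increasing) auto
    then have "2 * card V \<le> 2 ^ r * card V" by simp
    ultimately show "N * card {v \<in> V. v # R \<in> M} \<ge> 2 * card V" by linarith
  qed
  then obtain F' T where FT: "F' \<subseteq> F" "card F' = s" "T \<subseteq> V" "card T = t"
      "\<And>v R. v \<in> T \<Longrightarrow> R \<in> F' \<Longrightarrow> v # R \<in> M" by blast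
  have al: "aligned r F'" using aligned_subset[OF F(3) FT(1)] .
  define W where "W i = (if i < r then (\<lambda>R. R ! i) ` F' else T)" for i
  have len: "length R = r \<and> set R \<subseteq> V" if "R \<in> F'" for R
    using that FT(1) F(1) by (auto simp: clique_lists_def)
  have adjT: "adj v (R ! q)" if "v \<in> T" "R \<in> F'" "q < r" for v R q
  proof -
    have "v # R \<in> clique_lists (Suc r)" using FT(5)[OF that(1,2)] by (simp add: M_def)
    then show ?thesis using that(3) by (auto simp: clique_lists_def)
  qed
  show ?thesis
  proof (intro exI[of _ W] conjI allI impI)
    fix i assume i: "i < r + 1"
    show "W i \<subseteq> V"
    proof (cases "i < r")
      case True
      have "R ! i \<in> V" if "R \<in> F'" for R using len[OF that] nth_mem[of i R] True by blast
      then show ?thesis using True by (auto simp: W_def)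
    qed (use FT(3) in \<open>simp add: W_def\<close>)
    show "card (W i) = (if i < r then s else t)"
      using FT(2,4) al unfolding aligned_def by (simp add: W_def card_image)
  next
    fix i j assume ij: "i < r + 1" "j < r + 1" "i \<noteq> j"
    show "\<forall>x\<in>W i. \<forall>y\<in>W j. adj x y"
    proof (intro ballI)
      fix x y assume x: "x \<in> W i" and y: "y \<in> W j"
      consider "i < r" "j < r" | "i < r" "j = r" | "i = r" "j < r" using ij by linarith
      then show "adj x y"
      proof cases
        case 1
        then show ?thesis using x y ij al by (auto simp: W_def aligned_def)
      next
        case 2
        then show ?thesis using x y adjT by (auto simp: W_def intro: adj_sym)
      next
        case 3
        then show ?thesis using x y adjT by (auto simp: W_def)
      qed
    qed
  qed
qed

end

subsection \<open>Distance to the Turan graph\<close>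

text \<open>Within each colour as many elements as possible are matched, namely the minimum of the
  two class sizes, and the rest is matched arbitrarily. The truncated subtraction is the surplus of
  \<open>A\<close> over \<open>B\<close> in colour \<open>j\<close>.\<close>

lemma exists_bij_matching_colours:
  fixes f :: "'b \<Rightarrow> nat" and g :: "'a \<Rightarrow> nat"
  assumes fin: "finite A" "finite B" and card: "card A = card B"
    and g: "\<And>a. a \<in> A \<Longrightarrow> g a < r"
  shows "\<exists>\<pi>. bij_betw \<pi> A B \<and>
    card {a \<in> A. f (\<pi> a) \<noteq> g a} \<le> (\<Sum>j<r. card {a \<in> A. g a = j} - card {b \<in> B. f b = j})"
proof -
  let ?m = "\<lambda>j. min (card {a \<in> A. g a = j}) (card {b \<in> B. f b = j})"
  have "\<exists>X Y h. X \<subseteq> {a \<in> A. g a = j} \<and> card X = ?m j \<and> Y \<subseteq> {b \<in> B. f b = j} \<and> bij_betw h X Y" for j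
  proof -
    obtain X where X: "X \<subseteq> {a \<in> A. g a = j}" "card X = ?m j" "finite X"
      using obtain_subset_with_card_n[of "?m j" "{a \<in> A. g a = j}"] by auto
    obtain Y where Y: "Y \<subseteq> {b \<in> B. f b = j}" "card Y = ?m j" "finite Y"
      using obtain_subset_with_card_n[of "?m j" "{b \<in> B. f b = j}"] by auto
    show ?thesis using X Y finite_same_card_bij[of X Y] by metis
  qed
  then have "\<forall>j. \<exists>X Y h. X \<subseteq> {a \<in> A. g a = j} \<and> card X = ?m j \<and> Y \<subseteq> {b \<in> B. f b = j} \<and> bij_betw h X Y"
    by blast
  from choice[OF this] obtain X where
    "\<forall>j. \<exists>Y h. X j \<subseteq> {a \<in> A. g a = j} \<and> card (X j) = ?m j \<and> Y \<subseteq> {b \<in> B. f b = j} \<and> bij_betw h (X j) Y"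
    by blast
  from choice[OF this] obtain Y where
    "\<forall>j. \<exists>h. X j \<subseteq> {a \<in> A. g a = j} \<and> card (X j) = ?m j \<and> Y j \<subseteq> {b \<in> B. f b = j} \<and> bij_betw h (X j) (Y j)"
    by blast
  from choice[OF this] obtain h where XY: "\<And>j. X j \<subseteq> {a \<in> A. g a = j}" "\<And>j. card (X j) = ?m j"
     "\<And>j. Y j \<subseteq> {b \<in> B. f b = j}" "\<And>j. bij_betw (h j) (X j) (Y j)" by blast
  define A' where "A' = (\<Union>j<r. X j)"
  define H where "H a = h (g a) a" for a
  have HX: "H a = h j a" if "a \<in> X j" for a j using that XY(1) by (auto simp: H_def)
  have HY: "H a \<in> Y j" if "a \<in> X j" for a j
    using that XY(4)[of j] HX[OF that] by (auto simp: bij_betw_def)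
  have A'A: "A' \<subseteq> A" using XY(1) by (auto simp: A'_def)
  have inj: "inj_on H A'"
  proof (rule inj_onI)
    fix a b assume ab: "a \<in> A'" "b \<in> A'" and e: "H a = H b"
    then obtain i j where ij: "a \<in> X i" "b \<in> X j" by (auto simp: A'_def)
    have "f (H a) = i" "f (H b) = j" using HY[OF ij(1)] HY[OF ij(2)] XY(3) by auto
    then have "i = j" using e by simp
    then show "a = b" using ij e HX XY(4)[of j] by (auto simp: bij_betw_def inj_on_def)
  qed
  define B' where "B' = H ` A'"
  have B'B: "B' \<subseteq> B" using HY XY(3) by (fastforce simp: B'_def A'_def)
  have "card B' = card A'" unfolding B'_def by (rule card_image[OF inj])
  then have "card (A - A') = card (B - B')"
    using A'A B'B fin card by (simp add: card_Diff_subset finite_subset)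
  then obtain k where k: "bij_betw k (A - A') (B - B')"
    using finite_same_card_bij fin by (metis finite_Diff)
  define \<pi> where "\<pi> a = (if a \<in> A' then H a else k a)" for a
  have "bij_betw \<pi> (A' \<union> (A - A')) (B' \<union> (B - B'))"
  proof (rule bij_betw_combine)
    show "bij_betw \<pi> A' B'" using inj by (auto simp: bij_betw_def B'_def \<pi>_def inj_on_def)
    show "bij_betw \<pi> (A - A') (B - B')" using k by (subst bij_betw_cong[of _ _ k]) (auto simp: \<pi>_def)
  qed auto
  then have bij: "bij_betw \<pi> A B" using A'A B'B by (simp add: Un_absorb1)
  have "f (\<pi> a) = g a" if a: "a \<in> A'" for a
  proof -
    obtain j where "a \<in> X j" using a by (auto simp: A'_def)
    then have "f (H a) = j" "g a = j" using HY[of a j] XY(1)[of j] XY(3)[of j] by auto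
    then show ?thesis using a by (simp add: \<pi>_def)
  qed
  then have "{a \<in> A. f (\<pi> a) \<noteq> g a} \<subseteq> A - A'" by auto
  then have "card {a \<in> A. f (\<pi> a) \<noteq> g a} \<le> card (A - A')" using fin by (intro card_mono) auto
  also have "A - A' \<subseteq> (\<Union>j<r. {a \<in> A. g a = j} - X j)" using g by (auto simp: A'_def)
  then have "card (A - A') \<le> card (\<Union>j<r. {a \<in> A. g a = j} - X j)" using fin by (intro card_mono) auto
  also have "\<dots> \<le> (\<Sum>j<r. card ({a \<in> A. g a = j} - X j))" by (rule card_UN_le) auto
  also have "\<dots> = (\<Sum>j<r. card {a \<in> A. g a = j} - card {b \<in> B. f b = j})"
  proof (rule sum.cong[OF refl])
    fix j
    have "card ({a \<in> A. g a = j} - X j) = card {a \<in> A. g a = j} - card (X j)"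
      using XY(1) fin by (intro card_Diff_subset) (auto intro: finite_subset)
    then show "card ({a \<in> A. g a = j} - X j) = card {a \<in> A. g a = j} - card {b \<in> B. f b = j}"
      using XY(2)[of j] by simp
  qed
  finally show ?thesis using bij by blast
qed

lemma card_residue_class_le:
  assumes "r > 0"
  shows "card {i \<in> {..<n}. i mod r = j} \<le> n div r + 1"
proof -
  have "{i \<in> {..<n}. i mod r = j} \<subseteq> (\<lambda>q. q * r + j) ` {..n div r}"
  proof
    fix i assume i: "i \<in> {i \<in> {..<n}. i mod r = j}"
    then have "i = (i div r) * r + j" by auto
    moreover have "i div r \<le> n div r" using i by (intro div_le_mono) auto
    ultimately show "i \<in> (\<lambda>q. q * r + j) ` {..n div r}" by blast
  qed
  then have "card {i \<in> {..<n}. i mod r = j} \<le> card {..n div r}" by (rule surj_card_le[rotated]) simp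
  then show ?thesis by simp
qed

text \<open>Dense edges with few inner ones force the classes of \<open>f\<close> to be almost
  balanced and almost completely joined. A bijection respecting most classes then leaves three kinds
  of errors: inner edges (\<open>\<kappa>\<close>), missing cross pairs
  (\<open>e + \<kappa>\<close>), and pairs at vertices that land in the wrong class (the square root
  and \<open>r / n\<close>).\<close>

lemma turan_distance_le:
  fixes f :: "nat \<Rightarrow> nat" and e \<kappa> :: real
  assumes G: "graph_on n E" and r: "r \<ge> 1" and n: "n > 0" and f: "\<And>v. f v < r"
    and inside: "real (card {(a,b). a < n \<and> b < n \<and> {a,b} \<in> E \<and> f a = f b}) \<le> \<kappa> * (real n)\<^sup>2"
    and dense: "real (card {(a,b). a < n \<and> b < n \<and> {a,b} \<in> E}) \<ge> (1 - 1 / real r - e) * (real n)\<^sup>2"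
  shows "\<exists>\<pi>. bij_betw \<pi> {..<n} {..<n} \<and>
    real (card ((E - (`) \<pi> ` turan_edges r n) \<union> ((`) \<pi> ` turan_edges r n - E)))
      \<le> (e + 2 * \<kappa> + sqrt (real r * (e + \<kappa>)) + real r / real n) * (real n)\<^sup>2"
proof -
  define c where "c j = card {v \<in> {..<n}. f v = j}" for j
  define I where "I = {(a,b). a < n \<and> b < n \<and> {a,b} \<in> E \<and> f a = f b}"
  define P where "P = {(a,b). a < n \<and> b < n \<and> {a,b} \<in> E}"
  define Q where "Q = {(a,b). a < n \<and> b < n \<and> f a = f b}"
  define M where "M = {(a,b). a < n \<and> b < n \<and> {a,b} \<notin> E \<and> f a \<noteq> f b}"
  have fin: "finite I" "finite P" "finite Q" "finite M"
    by (rule finite_subset[of _ "{..<n} \<times> {..<n}"]; auto simp: I_def P_def Q_def M_def)+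
  \<comment> \<open>All ordered pairs, diagonal included, split into pairs within a class, adjacent
    cross pairs and missing cross pairs.\<close>
  have "{..<n} \<times> {..<n} = Q \<union> ((P - I) \<union> M)" by (auto simp: Q_def P_def I_def M_def)
  then have "card ({..<n} \<times> {..<n}) = card (Q \<union> ((P - I) \<union> M))" by simp
  also have "\<dots> = card Q + (card (P - I) + card M)"
    using fin by (subst card_Un_disjoint, auto simp: Q_def P_def I_def M_def)+
  also have "card (P - I) = card P - card I" using fin by (intro card_Diff_subset) (auto simp: P_def I_def)
  finally have tot: "real n * real n = real (card Q) + (real (card P) - real (card I)) + real (card M)"
  proof -
    assume a: "card ({..<n} \<times> {..<n}) = card Q + (card P - card I + card M)"
    have "card I \<le> card P" using fin by (intro card_mono) (auto simp: P_def I_def)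
    then have "real (card ({..<n} \<times> {..<n})) = real (card Q) + (real (card P) - real (card I)) + real (card M)"
      using a by (simp add: of_nat_diff)
    then show ?thesis by simp
  qed
  have "Q = (\<Union>j<r. {v \<in> {..<n}. f v = j} \<times> {v \<in> {..<n}. f v = j})"
    using f by (auto simp: Q_def)
  also have "card \<dots> = (\<Sum>j<r. card ({v \<in> {..<n}. f v = j} \<times> {v \<in> {..<n}. f v = j}))"
    by (rule card_UN_disjoint) auto
  finally have Qc: "real (card Q) = (\<Sum>j<r. (real (c j))\<^sup>2)"
    by (simp add: c_def card_cartesian_product power2_eq_square)
  have "{..<n} = (\<Union>j<r. {v \<in> {..<n}. f v = j})" using f by auto
  then have "card {..<n} = card (\<Union>j<r. {v \<in> {..<n}. f v = j})" by (rule arg_cong)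
  also have "\<dots> = (\<Sum>j<r. c j)" unfolding c_def by (rule card_UN_disjoint) auto
  finally have nc: "real n = (\<Sum>j<r. real (c j))" by simp
  \<comment> \<open>Deviation of a class from the balanced size. The squares add up to the excess of
    \<open>card Q\<close> over \<open>n\<^sup>2 / r\<close>; its nonnegativity bounds the missing
    pairs, its smallness the imbalance.\<close>
  define x where "x j = real (c j) - real n / real r" for j
  have sq: "(\<Sum>j<r. (x j)\<^sup>2) = real (card Q) - (real n)\<^sup>2 / real r"
  proof -
    have "(\<Sum>j<r. (x j)\<^sup>2) = (\<Sum>j<r. (real (c j))\<^sup>2 - 2 * (real n / real r) * real (c j) + (real n / real r)\<^sup>2)"
      by (intro sum.cong refl) (simp add: x_def power2_eq_square algebra_simps)
    also have "\<dots> = real (card Q) - 2 * (real n / real r) * real n + real r * (real n / real r)\<^sup>2"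
      by (simp add: sum.distrib sum_subtractf Qc sum_distrib_left[symmetric] sum_divide_distrib[symmetric] nc[symmetric])
    also have "\<dots> = real (card Q) - (real n)\<^sup>2 / real r"
      using r by (simp add: power2_eq_square field_simps)
    finally show ?thesis .
  qed
  have Qlow: "real (card Q) \<ge> (real n)\<^sup>2 / real r" using sq sum_nonneg[of "{..<r}" "\<lambda>j. (x j)\<^sup>2"] by simp
  have Ile: "real (card I) \<le> \<kappa> * (real n)\<^sup>2" using inside by (simp add: I_def)
  have Pge: "real (card P) \<ge> (1 - 1 / real r - e) * (real n)\<^sup>2" using dense by (simp add: P_def)
  have Pge': "real (card P) \<ge> (real n)\<^sup>2 - (real n)\<^sup>2 / real r - e * (real n)\<^sup>2"
    using Pge by (simp add: algebra_simps)
  have Mle: "real (card M) \<le> (e + \<kappa>) * (real n)\<^sup>2"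
    using tot Qlow Ile Pge' by (simp add: algebra_simps power2_eq_square)
  have xle: "(\<Sum>j<r. (x j)\<^sup>2) \<le> (e + \<kappa>) * (real n)\<^sup>2"
  proof -
    have "real (card M) \<ge> 0" by simp
    moreover have "(real n)\<^sup>2 = real (card Q) + (real (card P) - real (card I)) + real (card M)"
      using tot by (simp add: power2_eq_square)
    ultimately show ?thesis unfolding distrib_right using sq Ile Pge' by linarith
  qed
  obtain \<pi> where \<pi>: "bij_betw \<pi> {..<n} {..<n}" and bad:
     "card {a \<in> {..<n}. f (\<pi> a) \<noteq> a mod r} \<le> (\<Sum>j<r. card {a \<in> {..<n}. a mod r = j} - card {b \<in> {..<n}. f b = j})"
    using exists_bij_matching_colours[of "{..<n}" "{..<n}" "\<lambda>a. a mod r" r f] r by auto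
  \<comment> \<open>The vertices whose class under \<open>f\<close> differs from the Turan class
    carried over by \<open>\<pi>\<close>.\<close>
  define Z where "Z = \<pi> ` {a \<in> {..<n}. f (\<pi> a) \<noteq> a mod r}"
  have Zn: "Z \<subseteq> {..<n}" using \<pi> by (auto simp: Z_def bij_betw_def)
  have "real (card Z) \<le> real (card {a \<in> {..<n}. f (\<pi> a) \<noteq> a mod r})"
    unfolding Z_def using card_image_le[of "{a \<in> {..<n}. f (\<pi> a) \<noteq> a mod r}" \<pi>] by simp
  also have "\<dots> \<le> (\<Sum>j<r. real (card {a \<in> {..<n}. a mod r = j} - c j))"
    using bad unfolding c_def by (simp only: of_nat_sum[symmetric] of_nat_le_iff)
  \<comment> \<open>A Turan part exceeds \<open>n / r\<close> by at most one vertex; over all parts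
    this costs \<open>r\<close> vertices, hence the term \<open>r / n\<close> at the end.\<close>
  also have "\<dots> \<le> (\<Sum>j<r. \<bar>x j\<bar> + 1)"
  proof (rule sum_mono)
    fix j
    have "real (card {a \<in> {..<n}. a mod r = j}) \<le> real (n div r + 1)"
      using card_residue_class_le[of r n j] r by (simp only: of_nat_le_iff)
    also have "\<dots> \<le> real n / real r + 1" using of_nat_div_le_of_nat[of n r, where 'a = real] by simp
    finally show "real (card {a \<in> {..<n}. a mod r = j} - c j) \<le> \<bar>x j\<bar> + 1"
      unfolding x_def by linarith
  qed
  also have "\<dots> = (\<Sum>j<r. \<bar>x j\<bar>) + real r" by (simp add: sum.distrib)
  also have "(\<Sum>j<r. \<bar>x j\<bar>) \<le> sqrt (real r * (e + \<kappa>)) * real n"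
  proof -
    have "(\<Sum>j<r. 1 * \<bar>x j\<bar>)\<^sup>2 \<le> (\<Sum>j<r. 1\<^sup>2) * (\<Sum>j<r. \<bar>x j\<bar>\<^sup>2)" by (rule Cauchy_Schwarz_ineq_sum)
    also have "\<dots> \<le> real r * ((e + \<kappa>) * (real n)\<^sup>2)" using xle by (simp add: mult_left_mono)
    finally have "(\<Sum>j<r. \<bar>x j\<bar>)\<^sup>2 \<le> real r * (e + \<kappa>) * (real n)\<^sup>2" by (simp add: mult.assoc)
    then have "(\<Sum>j<r. \<bar>x j\<bar>) \<le> sqrt (real r * (e + \<kappa>) * (real n)\<^sup>2)" by (rule real_le_rsqrt)
    then show ?thesis by (simp add: real_sqrt_mult)
  qed
  finally have Zle: "real (card Z) \<le> sqrt (real r * (e + \<kappa>)) * real n + real r" by simp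
  define S where "S = (E - (`) \<pi> ` turan_edges r n) \<union> ((`) \<pi> ` turan_edges r n - E)"
  have good: "f (\<pi> i) = i mod r" if "i < n" "\<pi> i \<notin> Z" for i using that by (auto simp: Z_def)
  have "S \<subseteq> (\<lambda>(a,b). {a,b}) ` (I \<union> M \<union> Z \<times> {..<n})"
  proof
    fix s assume "s \<in> S"
    have key: "s \<in> (\<lambda>(a,b). {a,b}) ` (I \<union> M \<union> Z \<times> {..<n})"
      if s: "s = {\<pi> i, \<pi> j}" and ij: "i < n" "j < n" and
         q: "(\<pi> i, \<pi> j) \<in> I \<union> M \<or> \<pi> i \<in> Z \<or> \<pi> j \<in> Z" for i j
    proof -
      have n': "\<pi> i < n" "\<pi> j < n" using \<pi> ij by (auto simp: bij_betw_def)
      consider "(\<pi> i, \<pi> j) \<in> I \<union> M" | "\<pi> i \<in> Z" | "\<pi> j \<in> Z" using q by blast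
      then show ?thesis
      proof cases
        case 1
        then show ?thesis using s by (intro image_eqI[of _ _ "(\<pi> i, \<pi> j)"]) auto
      next
        case 2
        then show ?thesis using s n' by (intro image_eqI[of _ _ "(\<pi> i, \<pi> j)"]) auto
      next
        case 3
        then show ?thesis using s n' by (intro image_eqI[of _ _ "(\<pi> j, \<pi> i)"]) auto
      qed
    qed
    consider "s \<in> E" "s \<notin> (`) \<pi> ` turan_edges r n" | "s \<notin> E" "s \<in> (`) \<pi> ` turan_edges r n"
      using \<open>s \<in> S\<close> by (auto simp: S_def)
    then show "s \<in> (\<lambda>(a,b). {a,b}) ` (I \<union> M \<union> Z \<times> {..<n})"
    proof cases
      case 1
      then have "card s = 2" "s \<subseteq> {..<n}" using G by (auto simp: graph_on_def)
      then obtain u v where uv: "s = {u,v}" "u < n" "v < n" by (auto simp: card_2_iff)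
      then have "u \<in> \<pi> ` {..<n}" "v \<in> \<pi> ` {..<n}" using \<pi> by (auto simp: bij_betw_def)
      then obtain i j where ij: "i < n" "j < n" "u = \<pi> i" "v = \<pi> j" by auto
      have "i mod r = j mod r"
      proof (rule ccontr)
        assume "i mod r \<noteq> j mod r"
        then have "{i,j} \<in> turan_edges r n" using ij by (auto simp: turan_edges_def)
        moreover have "s = \<pi> ` {i,j}" using uv ij by simp
        ultimately show False using 1(2) by blast
      qed
      then have "(\<pi> i, \<pi> j) \<in> I" if "\<pi> i \<notin> Z" "\<pi> j \<notin> Z"
        using that good[of i] good[of j] ij uv 1 by (simp add: I_def)
      then show ?thesis using key[of i j] uv ij by blast
    next
      case 2
      then obtain i j where ij: "i < n" "j < n" "i mod r \<noteq> j mod r" "s = {\<pi> i, \<pi> j}"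
        by (auto simp: turan_edges_def)
      have "\<pi> i < n" "\<pi> j < n" using \<pi> ij by (auto simp: bij_betw_def)
      then have "(\<pi> i, \<pi> j) \<in> M" if "\<pi> i \<notin> Z" "\<pi> j \<notin> Z"
        using that good[of i] good[of j] ij 2 by (simp add: M_def)
      then show ?thesis using key[of i j] ij by blast
    qed
  qed
  then have "card S \<le> card (I \<union> M \<union> Z \<times> {..<n})"
    by (rule surj_card_le[rotated]) (use fin Zn in \<open>auto intro: finite_subset\<close>)
  also have "\<dots> \<le> card I + card M + card (Z \<times> {..<n})"
    by (meson card_Un_le le_trans add_le_mono1)
  finally have "real (card S) \<le> real (card I) + real (card M) + real (card Z) * real n"
    by (simp add: card_cartesian_product flip: of_nat_add of_nat_mult)
  also have "\<dots> \<le> \<kappa> * (real n)\<^sup>2 + (e + \<kappa>) * (real n)\<^sup>2 + (sqrt (real r * (e + \<kappa>)) * real n + real r) * real n"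
    using Ile Mle Zle by (intro add_mono mult_right_mono) auto
  also have "\<dots> = (e + 2 * \<kappa> + sqrt (real r * (e + \<kappa>)) + real r / real n) * (real n)\<^sup>2"
    using n by (simp add: power2_eq_square field_simps)
  finally show ?thesis using \<pi> unfolding S_def by blast
qed

subsection \<open>Constants\<close>

lemma two_power_le_exp: "(2::real) ^ k \<le> exp (real k)"
proof -
  have "(2::real) \<le> exp 1" using exp_ge_add_one_self[of 1] by simp
  then have "(2::real) ^ k \<le> exp 1 ^ k" by (rule power_mono) simp
  then show ?thesis by (simp add: exp_of_nat_mult[symmetric])
qed

text \<open>With \<open>N\<close> about \<open>1 / g ^ 7\<close>, the exponents
  \<open>s * N ^ r\<close> and \<open>s * N\<close> stay below a third of \<open>ln n\<close> and of
  \<open>sqrt c * ln n\<close> respectively. Crude exponential bounds then fit the first product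
  below \<open>n\<close>, and the second below
  \<open>n powr (1 - sqrt c) * n powr (sqrt c)\<close>.\<close>

lemma blow_up_sizes:
  fixes g c :: real
  assumes g: "0 < g" "g \<le> 1 / 4" and c: "c = g ^ (8 * (r + 1))" and r: "r \<ge> 2" and n: "n > 0"
    and big: "c * ln (real n) > 1"
    and N: "N = nat \<lceil>1 / g ^ 7\<rceil>" and s: "s = nat \<lfloor>c * ln (real n)\<rfloor>"
    and t: "t = nat \<lceil>real n powr (1 - sqrt c)\<rceil>"
  shows "N > 0" "s > 0" "N * 2 ^ (s * N ^ r) * (s * N ^ r) \<le> n" "t * 2 ^ (s * N) * N \<le> n"
proof -
  define L where "L = ln (real n)"
  have c0: "c > 0" using g c by simp
  have "0 < c * L" using big by (simp add: L_def)
  then have L: "L > 0" using c0 by (simp add: zero_less_mult_iff)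
  have nL: "real n = exp L" using n by (simp add: L_def)
  have g7: "g ^ 7 > 0" "g ^ 7 \<le> 1" using g by (auto intro: power_le_one)
  have ig: "1 \<le> 1 / g ^ 7" using g7 by simp
  have N0: "N > 0" unfolding N using g7 by simp
  have s0: "s > 0" unfolding s using big by (simp add: less_le_trans)
  show "N > 0" "s > 0" by (fact N0, fact s0)
  have "real N \<le> 1 / g ^ 7 + 1"
    unfolding N using ig by simp
  then have Nle: "real N \<le> 2 / g ^ 7" using ig by simp
  have sle: "real s \<le> c * L" unfolding s L_def using big by (simp add: of_nat_nat)
  have crude: "a * (2 ^ b * b) \<le> 2 ^ (3 * b)" if "a \<le> (2::nat) ^ b" for a b :: nat
  proof -
    have "a * (2 ^ b * b) \<le> 2 ^ b * (2 ^ b * 2 ^ b)"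
      using that less_imp_le[OF less_exp[of b]] by (intro mult_mono) auto
    also have "\<dots> = 2 ^ (3 * b)" by (simp add: power_add[symmetric])
    finally show ?thesis .
  qed
  define X where "X = s * N ^ r"
  have "real X = real s * real N ^ r" by (simp add: X_def)
  also have "\<dots> \<le> (c * L) * (2 / g ^ 7) ^ r"
    using sle Nle by (intro mult_mono power_mono) auto
  also have "\<dots> = L * ((2 * g) ^ r * g ^ 8)"
  proof -
    \<comment> \<open>The exponent splits as \<open>8 * (r + 1) = 8 + r + 7 * r\<close>: the part
      \<open>7 * r\<close> cancels \<open>N ^ r\<close>, the part \<open>r\<close> absorbs the
      factor \<open>2 ^ r\<close> from rounding, and \<open>g ^ 8\<close> is left over.\<close>
    have "c = g ^ 8 * g ^ r * (g ^ 7) ^ r"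
      unfolding c by (simp add: power_add[symmetric] power_mult[symmetric] algebra_simps)
    then show ?thesis using g by (simp add: power_divide power_mult_distrib)
  qed
  also have "\<dots> \<le> L * (1 * (1 / 4) ^ 8)"
    using g L by (intro mult_left_mono mult_mono power_le_one power_mono) auto
  also have "\<dots> \<le> L / 3" using L by (simp add: power_divide)
  finally have X3: "real (3 * X) \<le> L" by simp
  have "N \<le> N ^ r" using r N0 by (simp add: self_le_power)
  also have "\<dots> \<le> X" using s0 by (simp add: X_def)
  also have "\<dots> \<le> 2 ^ X" using less_exp[of X] by simp
  finally have "N * (2 ^ X * X) \<le> 2 ^ (3 * X)" by (rule crude)
  then have "real (N * (2 ^ X * X)) \<le> real (2 ^ (3 * X))" by (simp only: of_nat_le_iff)
  also have "\<dots> \<le> exp (real (3 * X))" using two_power_le_exp[of "3 * X"] by simp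
  also have "\<dots> \<le> real n" unfolding nL using X3 by simp
  finally show "N * 2 ^ (s * N ^ r) * (s * N ^ r) \<le> n"
    unfolding X_def[symmetric] by (simp only: of_nat_le_iff mult.assoc)
  define q where "q = sqrt c"
  have q: "q = g ^ (4 * (r + 1))"
  proof -
    have "c = (g ^ (4 * (r + 1)))\<^sup>2" unfolding c by (simp add: power_mult[symmetric])
    then show ?thesis using g by (simp add: q_def)
  qed
  have q1: "0 < q" "q \<le> 1" unfolding q using g by (auto intro: power_le_one)
  define Y where "Y = s * N"
  have "real Y = real s * real N" by (simp add: Y_def)
  also have "\<dots> \<le> (c * L) * (2 / g ^ 7)" using sle Nle by (intro mult_mono) auto
  also have "\<dots> = q * L * (2 * g ^ (4 * r - 3))"
  proof -
    have "q = g ^ 7 * g ^ (4 * r - 3)" unfolding q using r by (simp add: power_add[symmetric])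
    moreover have "c = q * q" using c0 by (simp add: q_def)
    ultimately have "c = q * (g ^ 7 * g ^ (4 * r - 3))" by simp
    then show ?thesis using g by simp
  qed
  also have "\<dots> \<le> q * L * (2 * (1 / 4) ^ 5)"
  proof -
    have "g ^ (4 * r - 3) \<le> g ^ 5" using g r by (intro power_decreasing) auto
    also have "\<dots> \<le> (1 / 4) ^ 5" using g by (intro power_mono) auto
    finally show ?thesis using q1 L by (intro mult_left_mono) auto
  qed
  also have "\<dots> \<le> q * L / 3" using q1 L by (simp add: power_divide)
  finally have Y3: "real (3 * Y) \<le> q * L" by simp
  have Y0: "Y > 0" using s0 N0 by (simp add: Y_def)
  have NY: "N \<le> Y" using s0 by (simp add: Y_def)
  have "2 * (2 ^ Y * N) \<le> 2 * (2 ^ Y * Y)" using NY by simp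
  also have "\<dots> \<le> 2 ^ (3 * Y)"
    using crude[of 2 Y] Y0 power_increasing[of 1 Y "2::nat"] by simp
  finally have "real (2 * (2 ^ Y * N)) \<le> real (2 ^ (3 * Y))" by (simp only: of_nat_le_iff)
  also have "\<dots> \<le> exp (real (3 * Y))" using two_power_le_exp[of "3 * Y"] by simp
  also have "\<dots> \<le> exp (q * L)" using Y3 by simp
  also have "\<dots> = real n powr q" using n by (simp add: powr_def L_def)
  finally have YN: "2 * (2 ^ Y * real N) \<le> real n powr q" by simp
  have n1: "real n \<ge> 1" using n by simp
  have "real n powr (1 - q) \<ge> 1" using n1 q1 by (intro ge_one_powr_ge_zero) auto
  \<comment> \<open>Rounding up at most doubles a number that is at least 1.\<close>
  then have "real t \<le> 2 * real n powr (1 - q)"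
    unfolding t q_def[symmetric] by (simp add: of_nat_nat) linarith
  then have "real t * (2 ^ Y * real N) \<le> 2 * real n powr (1 - q) * (2 ^ Y * real N)"
    by (rule mult_right_mono) simp
  also have "\<dots> = real n powr (1 - q) * (2 * (2 ^ Y * real N))" by simp
  also have "\<dots> \<le> real n powr (1 - q) * real n powr q" using YN by (intro mult_left_mono) auto
  also have "\<dots> = real n" using n by (simp add: powr_add[symmetric])
  finally have "real (t * (2 ^ Y * N)) \<le> real n" by simp
  then show "t * 2 ^ (s * N) * N \<le> n"
    unfolding Y_def[symmetric] by (simp only: of_nat_le_iff mult.assoc)
qed

text \<open>The budget: the square root takes \<open>p/2 + g/4\<close>, the linear terms
  \<open>p/4 + g/4\<close>, and \<open>w\<close> takes \<open>g/4\<close>, which is less than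
  \<open>p + g\<close> in total. The square root contributes order \<open>p\<^sup>2\<close> times a
  power of \<open>R\<close>, and the smallness of \<open>p * R ^ 6\<close> reduces this to a
  fraction of \<open>p\<close>.\<close>

lemma stability_constants:
  fixes R p g \<theta> w :: real
  assumes R: "R \<ge> 2" and p: "0 < p" "p * (512 * R ^ 6) < 1" and g: "0 < g" "g \<le> 1"
    and \<theta>: "0 \<le> \<theta>" "\<theta> * R ^ 101 \<le> g\<^sup>2" and w: "w \<le> g / 4"
    and e: "e = 2 * p ^ 4 + \<theta>" and \<kappa>: "\<kappa> = 2 * R\<^sup>2 * e + 3 * R * \<theta>"
  shows "e + 2 * \<kappa> + sqrt (R * (e + \<kappa>)) + w < p + g"
proof -
  have R2: "R\<^sup>2 \<ge> 2 * R" using R by (simp add: power2_eq_square)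
  have p1: "p * R ^ 6 \<le> 1 / 512" using p by simp
  have pR: "p\<^sup>2 * R ^ 12 \<le> 1 / 262144"
    using power_mono[OF p1, of 2] p R by (simp add: power_mult_distrib power_divide power_mult[symmetric])
  have R36: "R ^ 3 \<le> R ^ 12" "R\<^sup>2 \<le> R ^ 12" using R by (auto intro: power_increasing)
  have a1: "p\<^sup>2 * R ^ 3 \<le> 1 / 262144"
    using pR mult_left_mono[OF R36(1), of "p\<^sup>2"] by simp
  have a2: "p\<^sup>2 * R\<^sup>2 \<le> 1 / 262144"
    using pR mult_left_mono[OF R36(2), of "p\<^sup>2"] by simp
  have "1 \<le> R ^ 6" using R by (intro one_le_power) simp
  then have "p * 1 \<le> p * R ^ 6" using p by (intro mult_left_mono) auto
  then have ple: "p \<le> 1" using p1 by linarith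
  have b1: "5 * R ^ 3 * p ^ 4 \<le> (p / 2)\<^sup>2"
  proof -
    have "5 * R ^ 3 * p ^ 4 = 5 * p\<^sup>2 * (p\<^sup>2 * R ^ 3)" by (simp add: power2_eq_square power4_eq_xxxx)
    also have "\<dots> \<le> 5 * p\<^sup>2 * (1 / 262144)" using a1 by (intro mult_left_mono) auto
    also have "\<dots> \<le> (p / 2)\<^sup>2" by (simp add: power_divide)
    finally show ?thesis .
  qed
  have b2: "9 * R\<^sup>2 * p ^ 4 \<le> p / 4"
  proof -
    have "9 * R\<^sup>2 * p ^ 4 = 9 * p\<^sup>2 * (p\<^sup>2 * R\<^sup>2)" by (simp add: power2_eq_square power4_eq_xxxx)
    also have "\<dots> \<le> 9 * p\<^sup>2 * (1 / 262144)" using a2 by (intro mult_left_mono) auto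
    also have "\<dots> \<le> p\<^sup>2 / 4" by simp
    also have "\<dots> \<le> p / 4" using ple p by (simp add: power2_eq_square mult_left_le)
    finally show ?thesis .
  qed
  have pow: "80 * R ^ 3 \<le> R ^ 101"
  proof -
    have "(80::real) \<le> 2 ^ 98" by simp
    also have "\<dots> \<le> R ^ 98" using R by (intro power_mono) auto
    finally have "80 * R ^ 3 \<le> R ^ 98 * R ^ 3" using R by (intro mult_right_mono) auto
    then show ?thesis by (simp add: power_add[symmetric])
  qed
  have t1: "80 * R ^ 3 * \<theta> \<le> g\<^sup>2"
    using mult_right_mono[OF pow \<theta>(1)] \<theta>(2) by (simp add: mult.commute)
  have b3: "5 * R ^ 3 * \<theta> \<le> (g / 4)\<^sup>2" using t1 by (simp add: power_divide)
  have b4: "9 * R\<^sup>2 * \<theta> \<le> g / 4"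
  proof -
    have "R\<^sup>2 \<le> R ^ 3" using R by (intro power_increasing) auto
    moreover have "R ^ 3 \<ge> 0" using R by simp
    ultimately have "36 * R\<^sup>2 \<le> 80 * R ^ 3" by linarith
    then have "36 * R\<^sup>2 * \<theta> \<le> 80 * R ^ 3 * \<theta>" using \<theta>(1) by (rule mult_right_mono)
    also have "\<dots> \<le> g" using t1 g by (smt (verit) power2_eq_square mult_left_le)
    finally show ?thesis by simp
  qed
  have k: "\<kappa> = 4 * R\<^sup>2 * p ^ 4 + 2 * R\<^sup>2 * \<theta> + 3 * R * \<theta>" unfolding \<kappa> e by (simp add: algebra_simps)
  have "e + \<kappa> \<le> 5 * R\<^sup>2 * p ^ 4 + 5 * R\<^sup>2 * \<theta>"
  proof -
    have "2 * p ^ 4 \<le> R\<^sup>2 * p ^ 4" using R R2 by (intro mult_right_mono) auto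
    moreover have "(1 + 3 * R) * \<theta> \<le> 3 * R\<^sup>2 * \<theta>" using R R2 \<theta>(1) by (intro mult_right_mono) auto
    ultimately show ?thesis unfolding k e by (simp add: algebra_simps)
  qed
  then have "R * (e + \<kappa>) \<le> R * (5 * R\<^sup>2 * p ^ 4 + 5 * R\<^sup>2 * \<theta>)" using R by (intro mult_left_mono) auto
  also have "\<dots> = 5 * R ^ 3 * p ^ 4 + 5 * R ^ 3 * \<theta>" by (simp add: power2_eq_square power3_eq_cube algebra_simps)
  also have "\<dots> \<le> (p / 2)\<^sup>2 + (g / 4)\<^sup>2" using b1 b3 by simp
  also have "\<dots> \<le> (p / 2 + g / 4)\<^sup>2" using p g by (simp add: power2_sum)
  finally have "sqrt (R * (e + \<kappa>)) \<le> p / 2 + g / 4" using p g by (intro real_le_lsqrt) auto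
  moreover have "e + 2 * \<kappa> \<le> 9 * R\<^sup>2 * p ^ 4 + 9 * R\<^sup>2 * \<theta>"
  proof -
    have "2 * p ^ 4 \<le> R\<^sup>2 * p ^ 4" using R R2 by (intro mult_right_mono) auto
    moreover have "(1 + 6 * R) * \<theta> \<le> 5 * R\<^sup>2 * \<theta>" using R R2 \<theta>(1) by (intro mult_right_mono) auto
    ultimately show ?thesis unfolding k e by (simp add: algebra_simps)
  qed
  ultimately show ?thesis using b2 b4 w p g by linarith
qed

text \<open>Taking the root of order \<open>8 * r + 8\<close> of the bound on \<open>c\<close>
  leaves \<open>g \<le> r powr (- (r + 21))\<close>.\<close>

lemma power_threshold:
  fixes c :: real
  assumes c: "0 < c" "c < real r powr (- (8 * (real r + 21) * (real r + 1)))" and r: "r \<ge> 2"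
  defines "g \<equiv> c powr (1 / (8 * real r + 8))"
  shows "0 < g" "g ^ (8 * (r + 1)) = c" "g * real r ^ (r + 21) \<le> 1"
proof -
  show g0: "0 < g" using c by (simp add: g_def)
  have "g ^ (8 * (r + 1)) = g powr (real (8 * (r + 1)))" using g0 by (simp only: powr_realpow)
  also have "\<dots> = c" unfolding g_def powr_powr using c(1) by (simp add: field_simps)
  finally show "g ^ (8 * (r + 1)) = c" .
  have "g \<le> (real r powr (- (8 * (real r + 21) * (real r + 1)))) powr (1 / (8 * real r + 8))"
    unfolding g_def using c by (intro powr_mono2) auto
  also have "\<dots> = real r powr (- real (r + 21))"
  proof -
    have "- (8 * (real r + 21) * (real r + 1)) * (1 / (8 * real r + 8)) = - real (r + 21)"
      by (simp add: field_simps)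
    then show ?thesis unfolding powr_powr by simp
  qed
  finally have "g * real r powr (real (r + 21)) \<le> real r powr (- real (r + 21)) * real r powr (real (r + 21))"
    by (rule mult_right_mono) simp
  also have "\<dots> = 1" using r by (simp add: powr_add[symmetric])
  finally show "g * real r ^ (r + 21) \<le> 1" using r by (simp add: powr_realpow del: of_nat_add)
qed

text \<open>The numbers fit because \<open>(512 * r ^ 6) ^ 4 = 2 ^ 36 * r ^ 24\<close>.\<close>

lemma fourth_root_threshold:
  fixes \<epsilon> :: real
  assumes e: "0 < \<epsilon>" "\<epsilon> < 2 powr (-36) * real r powr (-24)" and r: "r \<ge> 2"
  defines "p \<equiv> \<epsilon> powr (1 / 4)"
  shows "0 < p" "p ^ 4 = \<epsilon>" "p * (512 * real r ^ 6) < 1"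
proof -
  show p0: "0 < p" using e by (simp add: p_def)
  have "p ^ 4 = p powr (real 4)" using p0 by (simp only: powr_realpow)
  also have "\<dots> = \<epsilon>" unfolding p_def powr_powr using e by simp
  finally show p4: "p ^ 4 = \<epsilon>" .
  have "(p * (512 * real r ^ 6)) ^ 4 = \<epsilon> * (2 ^ 36 * real r ^ 24)"
    by (simp add: power_mult_distrib p4 power_mult[symmetric])
  also have "\<dots> < (2 powr (-36) * real r powr (-24)) * (2 ^ 36 * real r ^ 24)"
    using e r by (intro mult_strict_right_mono) auto
  also have "\<dots> = (2 powr (-36) * 2 powr 36) * (real r powr (-24) * real r powr 24)"
    using r powr_realpow[of "real r" 24] powr_realpow[of 2 36] by simp
  also have "\<dots> = 1" using r by (simp only: powr_add[symmetric]) simp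
  finally have "(p * (512 * real r ^ 6)) ^ 4 < 1 ^ 4" by simp
  then show "p * (512 * real r ^ 6) < 1" by (rule power_less_imp_less_base) simp
qed

text \<open>One quantity \<open>\<theta>\<close> dominates every error caused by
  \<open>(r+1)\<close>-cliques. The exponent \<open>5 * r + 4\<close> collects
  \<open>r + 3 * (r + 1) + (r + 1)\<close>, using \<open>2 \<le> r\<close> and
  \<open>5 \<le> r ^ 3\<close>. Since \<open>5 * (r + 21) = (5 * r + 4) + 101\<close>, five factors
  of \<open>g\<close> absorb \<open>r ^ 101\<close> and two remain, just enough for the later square
  root.\<close>

lemma few_cliques_constants:
  fixes g H h :: real
  assumes r: "r \<ge> 2" and g: "0 < g" "g * real r ^ (r + 21) \<le> 1"
    and H: "0 \<le> H" "H \<le> 2 ^ (r + 1) * g ^ 7"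
  defines "\<theta> \<equiv> real r ^ (5 * r + 4) * g ^ 7"
  shows "0 \<le> \<theta>" "\<theta> * real r ^ 101 \<le> g\<^sup>2" "real r ^ r * 5 ^ (r + 1) * H \<le> \<theta>"
    "h \<ge> (1 / (2 * real r)) ^ (r - 1) \<Longrightarrow> H / h \<le> \<theta>"
proof -
  have R: "real r \<ge> 2" using r by simp
  show "0 \<le> \<theta>" using g by (simp add: \<theta>_def)
  have "\<theta> * real r ^ 101 = g\<^sup>2 * (g * real r ^ (r + 21)) ^ 5"
    by (simp add: \<theta>_def power_mult_distrib power_add[symmetric] power_mult[symmetric] algebra_simps)
  also have "\<dots> \<le> g\<^sup>2 * 1" using g by (intro mult_left_mono power_le_one) auto
  finally show "\<theta> * real r ^ 101 \<le> g\<^sup>2" by simp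
  have "(2::real) ^ (r + 1) \<le> real r ^ (r + 1)" using R by (intro power_mono) auto
  then have "2 ^ (r + 1) * g ^ 7 \<le> real r ^ (r + 1) * g ^ 7" using g by (intro mult_right_mono) auto
  then have H': "H \<le> real r ^ (r + 1) * g ^ 7" using H by linarith
  have "(5::real) \<le> 2 ^ 3" by simp
  also have "\<dots> \<le> real r ^ 3" using R by (intro power_mono) auto
  finally have "(5::real) ^ (r + 1) \<le> (real r ^ 3) ^ (r + 1)" by (intro power_mono) auto
  then have "real r ^ r * 5 ^ (r + 1) * H \<le> real r ^ r * (real r ^ 3) ^ (r + 1) * (real r ^ (r + 1) * g ^ 7)"
    using H' H by (intro mult_mono) auto
  also have "\<dots> = real r ^ (r + 3 * (r + 1) + (r + 1)) * g ^ 7"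
    by (simp only: power_add power_mult mult.assoc)
  also have "r + 3 * (r + 1) + (r + 1) = 5 * r + 4" by simp
  finally show "real r ^ r * 5 ^ (r + 1) * H \<le> \<theta>" by (simp only: \<theta>_def)
  assume h: "h \<ge> (1 / (2 * real r)) ^ (r - 1)"
  have h0: "(1 / (2 * real r)) ^ (r - 1) > 0" using R by simp
  have "H / h \<le> H / (1 / (2 * real r)) ^ (r - 1)" using h h0 H by (intro divide_left_mono) auto
  also have "\<dots> = H * (2 * real r) ^ (r - 1)" by (simp add: power_divide)
  also have "\<dots> \<le> (real r ^ (r + 1) * g ^ 7) * (real r ^ 2) ^ (r - 1)"
    using H' H R g by (intro mult_mono power_mono) (auto simp: power2_eq_square)
  also have "\<dots> = real r ^ (r + 1 + 2 * (r - 1)) * g ^ 7" by (simp add: power_add power_mult[symmetric])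
  also have "\<dots> \<le> \<theta>" unfolding \<theta>_def using g R by (intro mult_right_mono power_increasing) auto
  finally show "H / h \<le> \<theta>" .
qed

subsection \<open>Stability\<close>

text \<open>Eigenvector weights enter only through the edge density; the partition is built with
  uniform weights, for which clique densities and inner weights are normalised counts.\<close>

lemma few_cliques_stability:
  fixes g p :: real
  assumes G: "graph_on n E" and r: "r \<ge> 2" and n: "n > 0"
    and p: "0 < p" "p * (512 * real r ^ 6) < 1" and g: "0 < g" "g * real r ^ (r + 21) \<le> 1"
    and \<mu>: "spec_radius_graph n E > (1 - 1 / real r - p ^ 4) * real n"
    and few: "fin_graph.clique_density {..<n} (\<lambda>u v. {u,v} \<in> E) (\<lambda>_. 1 / real n) (r + 1) \<le> 2 ^ (r + 1) * g ^ 7"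
    and w: "real r / real n \<le> g / 4"
  shows "differs_from_turan_lt n E r ((p + g) * (real n)\<^sup>2)"
proof -
  interpret fin_graph "{..<n}" "\<lambda>u v. {u,v} \<in> E" by (rule fin_graph_edges[OF G])
  define y where "y = (\<lambda>_::nat. 1 / real n)"
  define H where "H = clique_density y (r + 1)"
  define \<theta> where "\<theta> = real r ^ (5 * r + 4) * g ^ 7"
  have y0: "y v \<ge> 0" for v by (simp add: y_def)
  have y1: "sum y {..<n} = 1" using n by (simp add: y_def)
  have R: "real r \<ge> 2" using r by simp
  have H0: "H \<ge> 0" unfolding H_def by (rule clique_density_nonneg[OF y0])
  have Hle: "H \<le> 2 ^ (r + 1) * g ^ 7" using few by (simp add: H_def y_def)
  note \<theta> = few_cliques_constants[OF r g H0 Hle, folded \<theta>_def]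
  define e where "e = 2 * p ^ 4 + \<theta>"
  have r6: "1 \<le> real r ^ 6" "1 \<le> real r ^ (r + 21)" using R by (auto intro: one_le_power)
  have g1: "g \<le> 1" using g r6 by (smt (verit) mult_left_le_one_le mult_le_cancel_left1)
  have pr: "p * real r ^ 6 < 1 / 512" using p by simp
  have "p * 1 \<le> p * real r ^ 6" using p r6 by (intro mult_left_mono) auto
  then have p1: "p < 1 / 512" using pr by linarith
  have p4: "p ^ 4 \<le> p" using power_decreasing[of 1 4 p] p p1 by simp
  obtain x where x: "(\<Sum>i<n. (x i)\<^sup>2) = 1"
    "\<And>i. i < n \<Longrightarrow> (\<Sum>j<n. (if {i,j} \<in> E then 1 else 0) * x j) = spec_radius_graph n E * x i"
    using spec_radius_eigenvector[OF n, of E] by blast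
  have "clique_density y 2 \<ge> 1 - 1 / real r - 2 * p ^ 4 - real r ^ r * 5 ^ (r + 1) * H"
    unfolding y_def H_def
    by (rule spectral_edge_density[of x "spec_radius_graph n E"]) (use x r n p p4 p1 \<mu> in auto)
  then have h2: "clique_density y 2 \<ge> 1 - 1 / real r - e" using \<theta>(3) by (simp add: e_def)
  define d where "d = 1 - clique_density y 2"
  have d: "clique_density y 2 = 1 - d" by (simp add: d_def)
  have d0: "d \<ge> 0" using clique_density_2_le_1[OF y0 y1] by (simp add: d_def)
  have de: "d \<le> 1 / real r + e" using h2 by (simp add: d_def)
  have e0: "e \<ge> 0" using \<theta>(1) by (simp add: e_def)
  \<comment> \<open>Keeps \<open>(r - 1) * d\<close> below 1 by the margin
    \<open>1 / (2 * r)\<close>, which then serves as \<open>b\<close> in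
    \<open>clique_density_lower\<close>.\<close>
  have er: "real r * (real r - 1) * e \<le> 1 / 2"
  proof -
    have "real r * (real r - 1) \<le> (real r)\<^sup>2" using R by (simp add: power2_eq_square algebra_simps)
    then have "real r * (real r - 1) * e \<le> (real r)\<^sup>2 * e" using e0 by (intro mult_right_mono)
    also have "\<dots> = 2 * ((real r)\<^sup>2 * p ^ 4) + (real r)\<^sup>2 * \<theta>" by (simp add: e_def algebra_simps)
    also have "(real r)\<^sup>2 * p ^ 4 \<le> real r ^ 6 * p"
      using p4 p R by (intro mult_mono power_increasing) auto
    also have "(real r)\<^sup>2 * \<theta> \<le> 1 / 4"
    proof -
      have "4 * (real r)\<^sup>2 \<le> (real r)\<^sup>2 * (real r)\<^sup>2" using R power_mono[of 2 "real r" 2] by (intro mult_right_mono) auto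
      also have "\<dots> \<le> real r ^ 101" unfolding power_add[symmetric] using R by (intro power_increasing) auto
      finally have "4 * (real r)\<^sup>2 * \<theta> \<le> real r ^ 101 * \<theta>" using \<theta>(1) by (intro mult_right_mono)
      also have "\<dots> \<le> g\<^sup>2" using \<theta>(2) by (simp add: mult.commute)
      also have "\<dots> \<le> 1" using g g1 by (simp add: power_le_one)
      finally show ?thesis by simp
    qed
    finally show ?thesis using pr by (simp add: mult.commute)
  qed
  have rd: "(real r - 1) * d \<le> 1 - 1 / (2 * real r)"
  proof -
    have "(real r - 1) * d \<le> (real r - 1) * (1 / real r + e)" using de R by (intro mult_left_mono) auto
    then have "real r * ((real r - 1) * d) \<le> real r * ((real r - 1) * (1 / real r + e))" using R by (intro mult_left_mono) auto
    also have "\<dots> = real r - 1 + real r * (real r - 1) * e" using R by (simp add: field_simps)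
    also have "\<dots> \<le> real r - 1 / 2" using er by linarith
    also have "\<dots> = real r * (1 - 1 / (2 * real r))" using R by (simp add: field_simps)
    finally show ?thesis using R by (simp add: mult_le_cancel_left_pos)
  qed
  moreover have "1 / (2 * real r) > 0" using R by simp
  ultimately have rd': "(real r - 1) * d < 1" by linarith
  have hr: "clique_density y r \<ge> (1 / (2 * real r)) ^ (r - 1)"
    using clique_density_lower[OF y0 y1 d d0 _ rd, of r] R by auto
  have Hh: "H / clique_density y r \<le> \<theta>" by (rule \<theta>(4)[OF hr])
  define \<kappa> where "\<kappa> = 2 * (real r)\<^sup>2 * e + 3 * real r * \<theta>"
  obtain f where f: "\<And>v. f v < r" and fI: "(\<Sum>(a,b)\<in>{(a,b). a \<in> {..<n} \<and> b \<in> {..<n} \<and> {a,b} \<in> E \<and> f a = f b}. y a * y b)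
     \<le> 2 * (1 - real r * (1 - (real r - 1) * d)) + 3 * real r * (clique_density y (r + 1) / clique_density y r)"
    using exists_good_partition[OF y0 y1 d d0 r rd'] by blast
  \<comment> \<open>Substituting \<open>d \<le> 1/r + e\<close> cancels the constant terms and
    leaves at most \<open>2 * r\<^sup>2 * e\<close> from the first summand.\<close>
  have "2 * (1 - real r * (1 - (real r - 1) * d)) + 3 * real r * (clique_density y (r + 1) / clique_density y r) \<le> \<kappa>"
  proof -
    have "real r * (real r - 1) * d \<le> real r * (real r - 1) * (1 / real r + e)"
      using de R by (intro mult_left_mono) auto
    also have "\<dots> = real r - 1 + real r * (real r - 1) * e" using R by (simp add: field_simps)
    also have "\<dots> \<le> real r - 1 + (real r)\<^sup>2 * e"
      using R e0 by (simp add: power2_eq_square algebra_simps)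
    finally have "2 * (1 - real r * (1 - (real r - 1) * d)) \<le> 2 * ((real r)\<^sup>2 * e)"
      by (simp add: algebra_simps)
    moreover have "3 * real r * (clique_density y (r + 1) / clique_density y r) \<le> 3 * real r * \<theta>"
      using Hh R unfolding H_def by (intro mult_left_mono) auto
    ultimately show ?thesis by (simp add: \<kappa>_def)
  qed
  with fI have "(\<Sum>(a,b)\<in>{(a,b). a < n \<and> b < n \<and> {a,b} \<in> E \<and> f a = f b}. y a * y b) \<le> \<kappa>" by simp
  then have "real (card {(a,b). a < n \<and> b < n \<and> {a,b} \<in> E \<and> f a = f b}) / (real n)\<^sup>2 \<le> \<kappa>"
    by (simp add: y_def split_beta power2_eq_square)
  then have inside: "real (card {(a,b). a < n \<and> b < n \<and> {a,b} \<in> E \<and> f a = f b}) \<le> \<kappa> * (real n)\<^sup>2"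
    using n by (simp add: field_simps)
  have "clique_density y 2 = real (card {(a,b). a < n \<and> b < n \<and> {a,b} \<in> E}) / (real n)\<^sup>2"
  proof -
    have "clique_density y 2 = (\<Sum>(a,b)\<in>{..<n} \<times> {..<n}. if {a,b} \<in> E then 1 / (real n)\<^sup>2 else 0)"
      unfolding clique_density_2[OF y0] sum.cartesian_product
      by (intro sum.cong) (auto simp: y_def power2_eq_square)
    also have "\<dots> = (\<Sum>q\<in>{q \<in> {..<n} \<times> {..<n}. {fst q, snd q} \<in> E}. 1 / (real n)\<^sup>2)"
      by (subst sum.inter_filter) (auto simp: split_beta)
    also have "{q \<in> {..<n} \<times> {..<n}. {fst q, snd q} \<in> E} = {(a,b). a < n \<and> b < n \<and> {a,b} \<in> E}" by auto
    finally show ?thesis by simp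
  qed
  with h2 have dense: "real (card {(a,b). a < n \<and> b < n \<and> {a,b} \<in> E}) \<ge> (1 - 1 / real r - e) * (real n)\<^sup>2"
    using n by (simp add: pos_le_divide_eq)
  obtain \<pi> where \<pi>: "bij_betw \<pi> {..<n} {..<n}"
    "real (card ((E - (`) \<pi> ` turan_edges r n) \<union> ((`) \<pi> ` turan_edges r n - E)))
      \<le> (e + 2 * \<kappa> + sqrt (real r * (e + \<kappa>)) + real r / real n) * (real n)\<^sup>2"
    using turan_distance_le[OF G _ n f inside dense] r by auto
  have "e + 2 * \<kappa> + sqrt (real r * (e + \<kappa>)) + real r / real n < p + g"
    by (rule stability_constants[OF R p g(1) g1 \<theta>(1,2) w e_def \<kappa>_def])
  then have "(e + 2 * \<kappa> + sqrt (real r * (e + \<kappa>)) + real r / real n) * (real n)\<^sup>2 < (p + g) * (real n)\<^sup>2"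
    using n by (intro mult_strict_right_mono) auto
  with \<pi> show ?thesis unfolding differs_from_turan_lt_def by (intro exI[of _ \<pi>]) linarith
qed

section \<open>Dichotomy on the number of \<open>(r+1)\<close>-cliques\<close>

theorem theorem1:
  fixes r n :: nat and c \<epsilon> :: real and E :: "nat set set"
  assumes "r \<ge> 2" and "n > 0"
    and "1 / ln (real n) < c" and "c < real r powr (- (8 * (real r + 21) * (real r + 1)))"
    and "0 < \<epsilon>" and "\<epsilon> < 2 powr (-36) * real r powr (-24)"
    and "graph_on n E"
    and "spec_radius_graph n E > (1 - 1 / real r - \<epsilon>) * real n"
  shows "contains_complete_multipartite n E (r + 1)
            (\<lambda>i. if i < r then nat \<lfloor>c * ln (real n)\<rfloor> else nat \<lceil>real n powr (1 - sqrt c)\<rceil>)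
         \<or> differs_from_turan_lt n E r ((\<epsilon> powr (1/4) + c powr (1 / (8 * real r + 8))) * (real n)^2)"
proof (cases "n = 1")
  case True
  have "contains_complete_multipartite n E (r + 1)
            (\<lambda>i. if i < r then nat \<lfloor>c * ln (real n)\<rfloor> else nat \<lceil>real n powr (1 - sqrt c)\<rceil>)"
    unfolding contains_complete_multipartite_def
    \<comment> \<open>Since \<open>ln 1 = 0\<close>, the first \<open>r\<close> parts have size 0
      and the last has size 1, so a single vertex suffices.\<close>
    by (rule exI[of _ "\<lambda>i. if i < r then {} else {0}"]) (auto simp: True)
  then show ?thesis ..
next
  case False
  then have n2: "n \<ge> 2" using assms(2) by simp
  have L: "ln (real n) > 0" using n2 by simp
  have c0: "c > 0" using assms(3) L by (smt (verit) zero_less_divide_1_iff)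
  have big: "c * ln (real n) > 1" using assms(3) L by (simp add: field_simps)
  define g where "g = c powr (1 / (8 * real r + 8))"
  define p where "p = \<epsilon> powr (1 / 4)"
  note g = power_threshold[OF c0 assms(4,1), folded g_def]
  note p = fourth_root_threshold[OF assms(5,6,1), folded p_def]
  have R: "real r \<ge> 2" using assms(1) by simp
  have g14: "g \<le> 1 / 4"
  proof -
    have "(4::real) \<le> 2 ^ 2" by simp
    also have "\<dots> \<le> real r ^ 2" using R by (intro power_mono) auto
    also have "\<dots> \<le> real r ^ (r + 21)" using R by (intro power_increasing) auto
    finally have "g * 4 \<le> g * real r ^ (r + 21)" using g(1) by (intro mult_left_mono) auto
    then show ?thesis using g(3) by simp
  qed
  interpret fin_graph "{..<n}" "\<lambda>u v. {u,v} \<in> E" by (rule fin_graph_edges[OF assms(7)])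
  define N where "N = nat \<lceil>1 / g ^ 7\<rceil>"
  note sizes = blow_up_sizes[OF g(1) g14 g(2)[symmetric] assms(1,2) big N_def refl refl]
  show ?thesis
  \<comment> \<open>The threshold asks whether the uniform \<open>(r+1)\<close>-clique density
    reaches \<open>2 ^ (r + 1) / N\<close>, where \<open>N\<close> is about
    \<open>1 / g ^ 7\<close>.\<close>
  proof (cases "2 ^ Suc r * card {..<n} ^ Suc r \<le> N * (fact (Suc r) * card (cliques (Suc r)))")
    case True
    have "\<exists>W. (\<forall>i<r + 1. W i \<subseteq> {..<n} \<and>
        card (W i) = (if i < r then nat \<lfloor>c * ln (real n)\<rfloor> else nat \<lceil>real n powr (1 - sqrt c)\<rceil>)) \<and>
      (\<forall>i<r + 1. \<forall>j<r + 1. i \<noteq> j \<longrightarrow> (\<forall>x\<in>W i. \<forall>y\<in>W j. {x,y} \<in> E))"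
      by (rule complete_multipartite_of_many_cliques[OF sizes(1) _ _ sizes(2) True])
        (use sizes(3,4) assms(1,2) in auto)
    then obtain W where W: "\<forall>i<r + 1. W i \<subseteq> {..<n} \<and>
        card (W i) = (if i < r then nat \<lfloor>c * ln (real n)\<rfloor> else nat \<lceil>real n powr (1 - sqrt c)\<rceil>)"
      "\<forall>i<r + 1. \<forall>j<r + 1. i \<noteq> j \<longrightarrow> (\<forall>x\<in>W i. \<forall>y\<in>W j. {x,y} \<in> E)" by blast
    have "W i \<inter> W j = {}" if "i < r + 1" "j < r + 1" "i \<noteq> j" for i j
      using W(2) that adj_irrefl by blast
    then have "contains_complete_multipartite n E (r + 1)
            (\<lambda>i. if i < r then nat \<lfloor>c * ln (real n)\<rfloor> else nat \<lceil>real n powr (1 - sqrt c)\<rceil>)"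
      unfolding contains_complete_multipartite_def using W by (intro exI[of _ W]) blast
    then show ?thesis ..
  next
    case False
    have "clique_density (\<lambda>_. 1 / real n) (r + 1) \<le> 2 ^ (r + 1) * g ^ 7"
    proof -
      have "real (N * (fact (Suc r) * card (cliques (Suc r)))) \<le> real (2 ^ Suc r * n ^ Suc r)"
        using False by (simp only: of_nat_le_iff card_lessThan)
      then have "real N * (fact (Suc r) * real (card (cliques (Suc r)))) \<le> 2 ^ Suc r * real n ^ Suc r"
        by (simp only: of_nat_mult of_nat_power of_nat_fact of_nat_numeral)
      then have "real N * clique_density (\<lambda>_. 1 / real n) (Suc r) \<le> 2 ^ Suc r"
        unfolding clique_density_uniform using assms(2) by (simp add: pos_divide_le_eq del: fact_Suc power_Suc)
      moreover have "1 / g ^ 7 \<le> real N" unfolding N_def by linarith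
      then have "1 / g ^ 7 * clique_density (\<lambda>_. 1 / real n) (Suc r) \<le> real N * clique_density (\<lambda>_. 1 / real n) (Suc r)"
        by (rule mult_right_mono) (rule clique_density_nonneg, simp)
      ultimately have "1 / g ^ 7 * clique_density (\<lambda>_. 1 / real n) (Suc r) \<le> 2 ^ Suc r" by linarith
      then show ?thesis using g(1) by (simp add: pos_divide_le_eq)
    qed
    \<comment> \<open>The hypothesis \<open>c * ln n > 1\<close> forces
      \<open>n \<ge> 1 / c\<close>, and \<open>c \<le> g ^ 3\<close> is small compared with
      \<open>g / r\<close>.\<close>
    moreover have "real r / real n \<le> g / 4"
    proof -
      have "1 / c < ln (real n)" using big c0 by (simp add: field_simps)
      also have "\<dots> \<le> real n" using ln_le_minus_one[of "real n"] assms(2) by simp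
      finally have "1 \<le> c * real n" using c0 by (simp add: field_simps)
      have "c \<le> g ^ 3" unfolding g(2)[symmetric] using g(1) g14 by (intro power_decreasing) auto
      also have "\<dots> = g * (g * g)" by (simp add: power3_eq_cube)
      also have "\<dots> \<le> g * (g * (1 / 4))" using g(1) g14 by (intro mult_left_mono) auto
      finally have "c * real r \<le> g * (g * (1 / 4)) * real r" by (intro mult_right_mono) auto
      also have "\<dots> = g / 4 * (g * real r)" by simp
      also have "\<dots> \<le> g / 4 * 1"
      proof -
        have "real r ^ 1 \<le> real r ^ (r + 21)" using R by (intro power_increasing) auto
        then have "g * real r \<le> g * real r ^ (r + 21)" using g(1) by (intro mult_left_mono) auto
        then have "g * real r \<le> 1" using g(3) by linarith
        then show ?thesis using g(1) by (intro mult_left_mono) auto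
      qed
      finally have "c * real r \<le> g / 4" by simp
      moreover have "real r * 1 \<le> real r * (c * real n)" using \<open>1 \<le> c * real n\<close> by (intro mult_left_mono) auto
      then have "real r / real n \<le> c * real r" using assms(2) by (simp add: field_simps)
      ultimately show ?thesis by linarith
    qed
    ultimately have "differs_from_turan_lt n E r ((p + g) * (real n)\<^sup>2)"
      using few_cliques_stability[OF assms(7,1,2) p(1,3) g(1,3)] assms(8) p(2) by simp
    then show ?thesis by (simp add: p_def g_def)
  qed
qed

end
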